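(* The geometric nerve functor $\mathrm{Ner}: 2\text{-}\mathrm{Cat}_{\mathrm{lax}} \to \mathrm{Sset}$, from the category of small 2-categories and (normal) lax 2-functors to the category of simplicial sets, is full and faithful. That is, for all small 2-categories $\mathbf{A},\mathbf{B}$, the map $F\mapsto \mathrm{Ner}(F)$ is a bijection from the set of lax 2-functors $\mathbf{A}\to\mathbf{B}$ onto the set of simplicial maps $\mathrm{Ner}(\mathbf{A})\to\mathrm{Ner}(\mathbf{B})$.
   Context: 2-categories are strict and small. All lax 2-functors are normal, and the structure 2-cells have the following direction. A lax 2-functor $F:\mathbf{A}\to\mathbf{B}$ consists of a map on objects $A\mapsto F(A)$; functors $\mathbf{A}(A,B)\to\mathbf{B}(F(A),F(B))$ on hom-categories (acting on 1-cells and 2-cells); and, for each composable pair of 1-cells $A_0\xrightarrow{f}A_1\xrightarrow{g}A_2$ in $\mathbf{A}$, a 2-cell $\sigma_{(f,g)}:F(gf)\Rightarrow F(g)F(f)$ in $\mathbf{B}$, natural in $f$ and $g$ with respect to 2-cells. These data satisfy: - Associativity coherence: for composable $f,g,k$, $(\sigma_{(g,k)}F(f))\circ\sigma_{(f,kg)}=(F(k)\sigma_{(f,g)})\circ\sigma_{(gf,k)}$ as 2-cells $F(kgf)\Rightarrow F(k)F(g)F(f)$. - Normality: $F(1_A)=1_{F(A)}$, the structural transformation for identities is an identity, and $\sigma_{(f,g)}$ is an identity 2-cell whenever $f$ or $g$ is an identity 1-cell. Lax 2-functors $F:\mathbf{A}\to\mathbf{B}$ and $G:\mathbf{B}\to\mathbf{C}$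 compose in the evident way, with structure 2-cells $\sigma^{G}_{(F(f),F(g))}\circ G(\sigma^F_{(f,g)})$. This gives the category $2\text{-}\mathrm{Cat}_{\mathrm{lax}}$ of small 2-categories and lax 2-functors. Let $\Delta$ be the simplicial category, with objects the finite non-empty linear orders $[n]=\{0\le 1\le\dots\le n\}$ and with monotonic maps as arrows. Regard each $[n]$ as a category and then as a 2-category with only identity 2-cells; this gives a full and faithful functor $\mathbf{i}:\Delta\to 2\text{-}\mathrm{Cat}_{\mathrm{lax}}$. The geometric nerve of a 2-category $\mathbf{A}$ is the simplicial set $\mathrm{Ner}(\mathbf{A})$ whose set of $n$-simplices is the set of lax 2-functors $[n]\to\mathbf{A}$, with simplicial operators given by precomposition. For a lax 2-functor $F:\mathbf{A}\to\mathbf{B}$, the simplicial map $\mathrm{Ner}(F)$ is given by composition with $F$. $\mathrm{Sset}$ is the category of simplicial sets. *)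

theory Defs
  imports "HOL-Library.FuncSet"
begin

section \<open>Strict 2-categories\<close>

text \<open>Both compositions are written in the usual applicative order: \<open>g \<cdot>\<^bsub>A\<^esub> f\<close> is
  ``\<open>f\<close>, then \<open>g\<close>''. The operations are only meaningful on the carriers and on composable
  arguments.\<close>

record ('o, 'm, 'c) twocat =
  Obj :: "'o set"
  Arr :: "'m set"
  Cell :: "'c set"
  src1 :: "'m \<Rightarrow> 'o"
  tgt1 :: "'m \<Rightarrow> 'o"
  src2 :: "'c \<Rightarrow> 'm"
  tgt2 :: "'c \<Rightarrow> 'm"
  id1 :: "'o \<Rightarrow> 'm"
  id2 :: "'m \<Rightarrow> 'c"
  comp1 :: "'m \<Rightarrow> 'm \<Rightarrow> 'm"  (infixl "\<cdot>\<index>" 70)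
  vcomp :: "'c \<Rightarrow> 'c \<Rightarrow> 'c"  (infixl "\<bullet>\<index>" 65)
  hcomp :: "'c \<Rightarrow> 'c \<Rightarrow> 'c"  (infixl "\<star>\<index>" 70)

definition composable :: "('o, 'm, 'c) twocat \<Rightarrow> ('m \<times> 'm) set" where
  "composable A = {(f, g). f \<in> Arr A \<and> g \<in> Arr A \<and> tgt1 A f = src1 A g}"

definition vcomposable :: "('o, 'm, 'c) twocat \<Rightarrow> ('c \<times> 'c) set" where
  "vcomposable A = {(a, b). a \<in> Cell A \<and> b \<in> Cell A \<and> tgt2 A a = src2 A b}"

definition hcomposable :: "('o, 'm, 'c) twocat \<Rightarrow> ('c \<times> 'c) set" where
  "hcomposable A = {(a, b). a \<in> Cell A \<and> b \<in> Cell A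
     \<and> tgt1 A (src2 A a) = src1 A (src2 A b)}"

locale two_category =
  fixes A :: "('o, 'm, 'c) twocat" (structure)
  assumes src1_Obj: "f \<in> Arr A \<Longrightarrow> src1 A f \<in> Obj A"
    and tgt1_Obj: "f \<in> Arr A \<Longrightarrow> tgt1 A f \<in> Obj A"
    and id1_Arr: "x \<in> Obj A \<Longrightarrow> id1 A x \<in> Arr A"
    and src1_id1: "x \<in> Obj A \<Longrightarrow> src1 A (id1 A x) = x"
    and tgt1_id1: "x \<in> Obj A \<Longrightarrow> tgt1 A (id1 A x) = x"
    and comp1_Arr: "(f, g) \<in> composable A \<Longrightarrow> g \<cdot> f \<in> Arr A"
    and src1_comp1: "(f, g) \<in> composable A \<Longrightarrow> src1 A (g \<cdot> f) = src1 A f"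
    and tgt1_comp1: "(f, g) \<in> composable A \<Longrightarrow> tgt1 A (g \<cdot> f) = tgt1 A g"
    and comp1_assoc: "\<lbrakk>(f, g) \<in> composable A; (g, k) \<in> composable A\<rbrakk>
          \<Longrightarrow> k \<cdot> (g \<cdot> f) = (k \<cdot> g) \<cdot> f"
    and comp1_id_right: "f \<in> Arr A \<Longrightarrow> f \<cdot> id1 A (src1 A f) = f"
    and comp1_id_left: "f \<in> Arr A \<Longrightarrow> id1 A (tgt1 A f) \<cdot> f = f"
    \<comment> \<open>hom-categories\<close>
    and src2_Arr: "a \<in> Cell A \<Longrightarrow> src2 A a \<in> Arr A"
    and tgt2_Arr: "a \<in> Cell A \<Longrightarrow> tgt2 A a \<in> Arr A"
    and src1_tgt2: "a \<in> Cell A \<Longrightarrow> src1 A (tgt2 A a) = src1 A (src2 A a)"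
    and tgt1_tgt2: "a \<in> Cell A \<Longrightarrow> tgt1 A (tgt2 A a) = tgt1 A (src2 A a)"
    and id2_Cell: "f \<in> Arr A \<Longrightarrow> id2 A f \<in> Cell A"
    and src2_id2: "f \<in> Arr A \<Longrightarrow> src2 A (id2 A f) = f"
    and tgt2_id2: "f \<in> Arr A \<Longrightarrow> tgt2 A (id2 A f) = f"
    and vcomp_Cell: "(a, b) \<in> vcomposable A \<Longrightarrow> b \<bullet> a \<in> Cell A"
    and src2_vcomp: "(a, b) \<in> vcomposable A \<Longrightarrow> src2 A (b \<bullet> a) = src2 A a"
    and tgt2_vcomp: "(a, b) \<in> vcomposable A \<Longrightarrow> tgt2 A (b \<bullet> a) = tgt2 A b"
    and vcomp_assoc: "\<lbrakk>(a, b) \<in> vcomposable A; (b, c) \<in> vcomposable A\<rbrakk>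
          \<Longrightarrow> c \<bullet> (b \<bullet> a) = (c \<bullet> b) \<bullet> a"
    and vcomp_id_right: "a \<in> Cell A \<Longrightarrow> a \<bullet> id2 A (src2 A a) = a"
    and vcomp_id_left: "a \<in> Cell A \<Longrightarrow> id2 A (tgt2 A a) \<bullet> a = a"
    \<comment> \<open>horizontal composition: functorial, associative and unital\<close>
    and hcomp_Cell: "(a, b) \<in> hcomposable A \<Longrightarrow> b \<star> a \<in> Cell A"
    and src2_hcomp: "(a, b) \<in> hcomposable A \<Longrightarrow> src2 A (b \<star> a) = src2 A b \<cdot> src2 A a"
    and tgt2_hcomp: "(a, b) \<in> hcomposable A \<Longrightarrow> tgt2 A (b \<star> a) = tgt2 A b \<cdot> tgt2 A a"
    and hcomp_id2: "(f, g) \<in> composable A \<Longrightarrow> id2 A g \<star> id2 A f = id2 A (g \<cdot> f)"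
    and interchange: "\<lbrakk>(a, a') \<in> vcomposable A; (b, b') \<in> vcomposable A; (a, b) \<in> hcomposable A\<rbrakk>
          \<Longrightarrow> (b' \<bullet> b) \<star> (a' \<bullet> a) = (b' \<star> a') \<bullet> (b \<star> a)"
    and hcomp_assoc: "\<lbrakk>(a, b) \<in> hcomposable A; (b, c) \<in> hcomposable A\<rbrakk>
          \<Longrightarrow> c \<star> (b \<star> a) = (c \<star> b) \<star> a"
    and hcomp_id_right: "a \<in> Cell A \<Longrightarrow> a \<star> id2 A (id1 A (src1 A (src2 A a))) = a"
    and hcomp_id_left: "a \<in> Cell A \<Longrightarrow> id2 A (id1 A (tgt1 A (src2 A a))) \<star> a = a"

section \<open>Normal lax 2-functors\<close>

text \<open>All components are required to be extensional (\<open>undefined\<close> off the carriers), so that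
  equality of records is equality of lax 2-functors. The structure cell \<open>\<sigma>\<^sub>(\<^sub>f\<^sub>,\<^sub>g\<^sub>)\<close> has the
  direction \<open>F(gf) \<Rightarrow> F(g)F(f)\<close>.\<close>

record ('o, 'm, 'c, 'p, 'q, 'd) lax =
  on0 :: "'o \<Rightarrow> 'p"
  on1 :: "'m \<Rightarrow> 'q"
  on2 :: "'c \<Rightarrow> 'd"
  sigma :: "'m \<times> 'm \<Rightarrow> 'd"

locale lax_functor = A: two_category A + B: two_category B
  for A :: "('o, 'm, 'c) twocat" and B :: "('p, 'q, 'd) twocat" +
  fixes F :: "('o, 'm, 'c, 'p, 'q, 'd) lax"
  assumes on0: "on0 F \<in> Obj A \<rightarrow>\<^sub>E Obj B"
    and on1: "on1 F \<in> Arr A \<rightarrow>\<^sub>E Arr B"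
    and on2: "on2 F \<in> Cell A \<rightarrow>\<^sub>E Cell B"
    and sigma: "sigma F \<in> composable A \<rightarrow>\<^sub>E Cell B"
    and src1_on1: "f \<in> Arr A \<Longrightarrow> src1 B (on1 F f) = on0 F (src1 A f)"
    and tgt1_on1: "f \<in> Arr A \<Longrightarrow> tgt1 B (on1 F f) = on0 F (tgt1 A f)"
    and src2_on2: "a \<in> Cell A \<Longrightarrow> src2 B (on2 F a) = on1 F (src2 A a)"
    and tgt2_on2: "a \<in> Cell A \<Longrightarrow> tgt2 B (on2 F a) = on1 F (tgt2 A a)"
    and on2_id2: "f \<in> Arr A \<Longrightarrow> on2 F (id2 A f) = id2 B (on1 F f)"
    and on2_vcomp: "(a, b) \<in> vcomposable A
          \<Longrightarrow> on2 F (b \<bullet>\<^bsub>A\<^esub> a) = on2 F b \<bullet>\<^bsub>B\<^esub> on2 F a"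
    and src2_sigma: "(f, g) \<in> composable A \<Longrightarrow> src2 B (sigma F (f, g)) = on1 F (g \<cdot>\<^bsub>A\<^esub> f)"
    and tgt2_sigma: "(f, g) \<in> composable A
          \<Longrightarrow> tgt2 B (sigma F (f, g)) = on1 F g \<cdot>\<^bsub>B\<^esub> on1 F f"
    and sigma_natural: "(a, b) \<in> hcomposable A
          \<Longrightarrow> sigma F (tgt2 A a, tgt2 A b) \<bullet>\<^bsub>B\<^esub> on2 F (b \<star>\<^bsub>A\<^esub> a)
            = (on2 F b \<star>\<^bsub>B\<^esub> on2 F a) \<bullet>\<^bsub>B\<^esub> sigma F (src2 A a, src2 A b)"
    and sigma_assoc: "\<lbrakk>(f, g) \<in> composable A; (g, k) \<in> composable A\<rbrakk>
          \<Longrightarrow> (sigma F (g, k) \<star>\<^bsub>B\<^esub> id2 B (on1 F f)) \<bullet>\<^bsub>B\<^esub> sigma F (f, k \<cdot>\<^bsub>A\<^esub> g)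
            = (id2 B (on1 F k) \<star>\<^bsub>B\<^esub> sigma F (f, g)) \<bullet>\<^bsub>B\<^esub> sigma F (g \<cdot>\<^bsub>A\<^esub> f, k)"
    and on1_id1: "x \<in> Obj A \<Longrightarrow> on1 F (id1 A x) = id1 B (on0 F x)"
    and sigma_id_first: "f \<in> Arr A \<Longrightarrow> sigma F (id1 A (src1 A f), f) = id2 B (on1 F f)"
    and sigma_id_second: "f \<in> Arr A \<Longrightarrow> sigma F (f, id1 A (tgt1 A f)) = id2 B (on1 F f)"

definition lax_functors ::
  "('o, 'm, 'c) twocat \<Rightarrow> ('p, 'q, 'd) twocat \<Rightarrow> ('o, 'm, 'c, 'p, 'q, 'd) lax set" where
  "lax_functors A B = {F. lax_functor A B F}"

definition lax_id :: "('o, 'm, 'c) twocat \<Rightarrow> ('o, 'm, 'c, 'o, 'm, 'c) lax" where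
  "lax_id A = \<lparr>on0 = \<lambda>x\<in>Obj A. x, on1 = \<lambda>f\<in>Arr A. f, on2 = \<lambda>a\<in>Cell A. a,
     sigma = \<lambda>(f, g)\<in>composable A. id2 A (g \<cdot>\<^bsub>A\<^esub> f)\<rparr>"

text \<open>\<open>lax_comp A C G F\<close> is the composite of \<open>F : A \<rightarrow> B\<close> with \<open>G : B \<rightarrow> C\<close>; the 2-category \<open>B\<close>
  is not needed to write down the data.\<close>

definition lax_comp :: "('o, 'm, 'c) twocat \<Rightarrow> ('u, 'v, 'w) twocat
    \<Rightarrow> ('p, 'q, 'd, 'u, 'v, 'w) lax \<Rightarrow> ('o, 'm, 'c, 'p, 'q, 'd) lax
    \<Rightarrow> ('o, 'm, 'c, 'u, 'v, 'w) lax" where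
  "lax_comp A C G F = \<lparr>on0 = compose (Obj A) (on0 G) (on0 F),
     on1 = compose (Arr A) (on1 G) (on1 F),
     on2 = compose (Cell A) (on2 G) (on2 F),
     sigma = \<lambda>(f, g)\<in>composable A.
       sigma G (on1 F f, on1 F g) \<bullet>\<^bsub>C\<^esub> on2 G (sigma F (f, g))\<rparr>"

section \<open>The simplicial category inside 2-categories and lax 2-functors\<close>

definition mono_maps :: "nat \<Rightarrow> nat \<Rightarrow> (nat \<Rightarrow> nat) set" where
  "mono_maps m n = {\<alpha>. \<alpha> \<in> {0..m} \<rightarrow>\<^sub>E {0..n} \<and> mono_on {0..m} \<alpha>}"

text \<open>The ordinal \<open>[n]\<close>: the unique 1-cell \<open>i \<rightarrow> j\<close>, for \<open>i \<le> j \<le> n\<close>, is the pair \<open>(i, j)\<close>, and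
  its identity 2-cell (the only kind of 2-cell) is the same pair.\<close>

definition ordinal :: "nat \<Rightarrow> (nat, nat \<times> nat, nat \<times> nat) twocat" where
  "ordinal n = \<lparr>Obj = {0..n}, Arr = {(i, j). i \<le> j \<and> j \<le> n}, Cell = {(i, j). i \<le> j \<and> j \<le> n},
     src1 = fst, tgt1 = snd, src2 = (\<lambda>a. a), tgt2 = (\<lambda>a. a),
     id1 = (\<lambda>i. (i, i)), id2 = (\<lambda>f. f),
     comp1 = (\<lambda>g f. (fst f, snd g)), vcomp = (\<lambda>b a. a), hcomp = (\<lambda>b a. (fst a, snd b))\<rparr>"

text \<open>A monotonic map out of \<open>[m]\<close> as a (strict) 2-functor; its structure cells are identities.\<close>

definition ordinal_map :: "nat \<Rightarrow> (nat \<Rightarrow> nat)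
    \<Rightarrow> (nat, nat \<times> nat, nat \<times> nat, nat, nat \<times> nat, nat \<times> nat) lax" where
  "ordinal_map m \<alpha> = \<lparr>on0 = restrict \<alpha> {0..m},
     on1 = \<lambda>(i, j)\<in>Arr (ordinal m). (\<alpha> i, \<alpha> j),
     on2 = \<lambda>(i, j)\<in>Cell (ordinal m). (\<alpha> i, \<alpha> j),
     sigma = \<lambda>(f, g)\<in>composable (ordinal m). (\<alpha> (fst f), \<alpha> (snd g))\<rparr>"

section \<open>Simplicial sets\<close>

text \<open>\<open>action X m n \<alpha> : X\<^sub>n \<rightarrow> X\<^sub>m\<close> is the simplicial operator of \<open>\<alpha> : [m] \<rightarrow> [n]\<close>.\<close>

record 's sset =
  simplices :: "nat \<Rightarrow> 's set"
  action :: "nat \<Rightarrow> nat \<Rightarrow> (nat \<Rightarrow> nat) \<Rightarrow> 's \<Rightarrow> 's"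

locale simplicial_set =
  fixes X :: "'s sset"
  assumes action_simplices: "\<lbrakk>\<alpha> \<in> mono_maps m n; x \<in> simplices X n\<rbrakk>
          \<Longrightarrow> action X m n \<alpha> x \<in> simplices X m"
    and action_id: "x \<in> simplices X n \<Longrightarrow> action X n n (\<lambda>i\<in>{0..n}. i) x = x"
    and action_comp: "\<lbrakk>\<alpha> \<in> mono_maps l m; \<beta> \<in> mono_maps m n; x \<in> simplices X n\<rbrakk>
          \<Longrightarrow> action X l n (compose {0..l} \<beta> \<alpha>) x = action X l m \<alpha> (action X m n \<beta> x)"

definition simplicial_maps :: "'s sset \<Rightarrow> 't sset \<Rightarrow> (nat \<Rightarrow> 's \<Rightarrow> 't) set" where
  "simplicial_maps X Y = {\<phi>. (\<forall>n. \<phi> n \<in> simplices X n \<rightarrow>\<^sub>E simplices Y n)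
     \<and> (\<forall>m n. \<forall>\<alpha>\<in>mono_maps m n. \<forall>x\<in>simplices X n.
          \<phi> m (action X m n \<alpha> x) = action Y m n \<alpha> (\<phi> n x))}"

definition sset_id :: "'s sset \<Rightarrow> nat \<Rightarrow> 's \<Rightarrow> 's" where
  "sset_id X = (\<lambda>n. \<lambda>x\<in>simplices X n. x)"

definition sset_comp ::
  "'s sset \<Rightarrow> (nat \<Rightarrow> 't \<Rightarrow> 'r) \<Rightarrow> (nat \<Rightarrow> 's \<Rightarrow> 't) \<Rightarrow> nat \<Rightarrow> 's \<Rightarrow> 'r" where
  "sset_comp X \<psi> \<phi> = (\<lambda>n. compose (simplices X n) (\<psi> n) (\<phi> n))"

section \<open>The geometric nerve\<close>

definition Ner :: "('o, 'm, 'c) twocat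
    \<Rightarrow> (nat, nat \<times> nat, nat \<times> nat, 'o, 'm, 'c) lax sset" where
  "Ner A = \<lparr>simplices = (\<lambda>n. lax_functors (ordinal n) A),
     action = (\<lambda>m n \<alpha> x. lax_comp (ordinal m) A x (ordinal_map m \<alpha>))\<rparr>"

definition Ner_map :: "('o, 'm, 'c) twocat \<Rightarrow> ('p, 'q, 'd) twocat
    \<Rightarrow> ('o, 'm, 'c, 'p, 'q, 'd) lax
    \<Rightarrow> nat \<Rightarrow> (nat, nat \<times> nat, nat \<times> nat, 'o, 'm, 'c) lax
    \<Rightarrow> (nat, nat \<times> nat, nat \<times> nat, 'p, 'q, 'd) lax" where
  "Ner_map A B F = (\<lambda>n. \<lambda>x\<in>simplices (Ner A) n. lax_comp (ordinal n) B F x)"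

end

theory Submission
  imports Defs
begin

text \<open>A normal lax 2-functor \<open>[n] \<rightarrow> A\<close> amounts to objects \<open>x\<^sub>i\<close>, 1-cells \<open>x\<^sub>i\<^sub>j\<close> for \<open>i < j\<close> and 2-cells
  \<open>x\<^sub>i\<^sub>j\<^sub>k : x\<^sub>i\<^sub>k \<Rightarrow> x\<^sub>j\<^sub>k x\<^sub>i\<^sub>j\<close> for \<open>i < j < k\<close>, subject to one equation for each
  \<open>i < j < k < l\<close>; so simplicial maps between nerves are determined in dimension 2. Write \<open>(f, g; a)\<close> for the
  triangle with sides \<open>f, g\<close> and filler \<open>a : h \<Rightarrow> gf\<close>. The nerve of \<open>F\<close> sends it to
  \<open>(F f, F g; \<sigma>\<^sub>(\<^sub>f\<^sub>,\<^sub>g\<^sub>) \<bullet> F a)\<close>. The triangles with \<open>a\<close> an identity recover \<open>\<sigma>\<close>, and those with \<open>g\<close>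
  an identity recover \<open>F a\<close>, whence faithfulness. For fullness, these two kinds of triangles define \<open>F\<close>
  from a simplicial map. Each axiom of a lax 2-functor, and the factorisation of the image of an
  arbitrary triangle as \<open>\<sigma>\<^sub>(\<^sub>f\<^sub>,\<^sub>g\<^sub>) \<bullet> F a\<close>, is the coherence equation of the image of a suitable
  tetrahedron in \<open>A\<close> with some of its edges or fillers identities.\<close>

section \<open>Lax 2-functors and their composition\<close>

lemma (in two_category) composable_iff [simp]:
  "(f, g) \<in> composable A \<longleftrightarrow> f \<in> Arr A \<and> g \<in> Arr A \<and> tgt1 A f = src1 A g"
  by (simp add: composable_def)

lemma (in two_category) vcomposable_iff [simp]:
  "(a, b) \<in> vcomposable A \<longleftrightarrow> a \<in> Cell A \<and> b \<in> Cell A \<and> tgt2 A a = src2 A b"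
  by (simp add: vcomposable_def)

lemma (in two_category) hcomposable_iff [simp]:
  "(a, b) \<in> hcomposable A \<longleftrightarrow>
     a \<in> Cell A \<and> b \<in> Cell A \<and> tgt1 A (src2 A a) = src1 A (src2 A b)"
  by (simp add: hcomposable_def)

lemmas (in two_category) typing [simp] =
  src1_Obj tgt1_Obj id1_Arr src1_id1 tgt1_id1 comp1_Arr src1_comp1 tgt1_comp1
  src2_Arr tgt2_Arr src1_tgt2 tgt1_tgt2 id2_Cell src2_id2 tgt2_id2
  vcomp_Cell src2_vcomp tgt2_vcomp hcomp_Cell src2_hcomp tgt2_hcomp hcomp_id2

lemma (in two_category) vcomp_id2 [simp]:
  "\<lbrakk>a \<in> Cell A; src2 A a = f\<rbrakk> \<Longrightarrow> a \<bullet> id2 A f = a"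
  "\<lbrakk>a \<in> Cell A; tgt2 A a = f\<rbrakk> \<Longrightarrow> id2 A f \<bullet> a = a"
  using vcomp_id_right vcomp_id_left by auto

lemma (in two_category) comp1_id1 [simp]:
  "\<lbrakk>f \<in> Arr A; src1 A f = x\<rbrakk> \<Longrightarrow> f \<cdot> id1 A x = f"
  "\<lbrakk>f \<in> Arr A; tgt1 A f = x\<rbrakk> \<Longrightarrow> id1 A x \<cdot> f = f"
  using comp1_id_right comp1_id_left by auto

lemma (in two_category) hcomp_id1 [simp]:
  "\<lbrakk>a \<in> Cell A; src1 A (src2 A a) = x\<rbrakk> \<Longrightarrow> a \<star> id2 A (id1 A x) = a"
  "\<lbrakk>a \<in> Cell A; tgt1 A (src2 A a) = x\<rbrakk> \<Longrightarrow> id2 A (id1 A x) \<star> a = a"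
  using hcomp_id_right hcomp_id_left by auto

text \<open>This is interchange with \<open>id2 A f\<close> in both places of one of the two
  vertical composites, as \<open>id2 A f \<bullet> id2 A f\<close> is again
  \<open>id2 A f\<close>.\<close>

lemma (in two_category) whisker_vcomp:
  assumes "a \<in> Cell A" "a' \<in> Cell A" "tgt2 A a = src2 A a'" "f \<in> Arr A"
  shows "tgt1 A f = src1 A (src2 A a) \<Longrightarrow>
      (a' \<bullet> a) \<star> id2 A f = (a' \<star> id2 A f) \<bullet> (a \<star> id2 A f)"
    and "tgt1 A (src2 A a) = src1 A f \<Longrightarrow>
      id2 A f \<star> (a' \<bullet> a) = (id2 A f \<star> a') \<bullet> (id2 A f \<star> a)"
  using assms interchange[of "id2 A f" "id2 A f" a a'] interchange[of a a' "id2 A f" "id2 A f"]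
  by auto

lemmas (in lax_functor) cells [simp] =
  PiE_mem[OF on0] PiE_mem[OF on1] PiE_mem[OF on2]
  src1_on1 tgt1_on1 src2_on2 tgt2_on2 on2_id2 on2_vcomp src2_sigma tgt2_sigma
  on1_id1

lemma (in lax_functor) sigma_Cell [simp]:
  "\<lbrakk>f \<in> Arr A; g \<in> Arr A; tgt1 A f = src1 A g\<rbrakk> \<Longrightarrow> sigma F (f, g) \<in> Cell B"
  using PiE_mem[OF sigma, of "(f, g)"] by simp

lemma (in lax_functor) sigma_ids [simp]:
  "\<lbrakk>f \<in> Arr A; src1 A f = x\<rbrakk> \<Longrightarrow> sigma F (id1 A x, f) = id2 B (on1 F f)"
  "\<lbrakk>f \<in> Arr A; tgt1 A f = x\<rbrakk> \<Longrightarrow> sigma F (f, id1 A x) = id2 B (on1 F f)"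
  using sigma_id_first sigma_id_second by auto

lemma lax_comp_sel [simp]:
  "x \<in> Obj A \<Longrightarrow> on0 (lax_comp A C G F) x = on0 G (on0 F x)"
  "f \<in> Arr A \<Longrightarrow> on1 (lax_comp A C G F) f = on1 G (on1 F f)"
  "a \<in> Cell A \<Longrightarrow> on2 (lax_comp A C G F) a = on2 G (on2 F a)"
  "(f, g) \<in> composable A \<Longrightarrow>
     sigma (lax_comp A C G F) (f, g) = sigma G (on1 F f, on1 F g) \<bullet>\<^bsub>C\<^esub> on2 G (sigma F (f, g))"
  by (simp_all add: lax_comp_def compose_def)

text \<open>Naturality at an identity cell, which \<open>on2 F\<close> preserves. This form and its
  mirror image are the ones needed for the coherence of a composite.\<close>

lemma (in lax_functor) sigma_natural_first:
  assumes "a \<in> Cell A" "g \<in> Arr A" "tgt1 A (src2 A a) = src1 A g"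
  shows "sigma F (tgt2 A a, g) \<bullet>\<^bsub>B\<^esub> on2 F (id2 A g \<star>\<^bsub>A\<^esub> a)
    = (id2 B (on1 F g) \<star>\<^bsub>B\<^esub> on2 F a) \<bullet>\<^bsub>B\<^esub> sigma F (src2 A a, g)"
  using sigma_natural[of a "id2 A g"] assms by simp

lemma (in lax_functor) sigma_natural_second:
  assumes "b \<in> Cell A" "f \<in> Arr A" "tgt1 A f = src1 A (src2 A b)"
  shows "sigma F (f, tgt2 A b) \<bullet>\<^bsub>B\<^esub> on2 F (b \<star>\<^bsub>A\<^esub> id2 A f)
    = (on2 F b \<star>\<^bsub>B\<^esub> id2 B (on1 F f)) \<bullet>\<^bsub>B\<^esub> sigma F (f, src2 A b)"
  using sigma_natural[of "id2 A f" b] assms by simp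

text \<open>The naturality square of the composite is the image under \<open>G\<close> of a square
  of \<open>F\<close>, pasted to a square of \<open>G\<close>. Its associativity equation combines
  the image under \<open>G\<close> of that of \<open>F\<close> with that of \<open>G\<close> at the
  images of \<open>f\<close>, \<open>g\<close>, \<open>k\<close>.\<close>

lemma lax_functor_comp:
  assumes "lax_functor A B F" and "lax_functor B C G"
  shows "lax_functor A C (lax_comp A C G F)"
proof -
  interpret F: lax_functor A B F by fact
  interpret G: lax_functor B C G by fact
  show ?thesis
  proof
    show "on0 (lax_comp A C G F) \<in> Obj A \<rightarrow>\<^sub>E Obj C"
      "on1 (lax_comp A C G F) \<in> Arr A \<rightarrow>\<^sub>E Arr C"
      "on2 (lax_comp A C G F) \<in> Cell A \<rightarrow>\<^sub>E Cell C"
      "sigma (lax_comp A C G F) \<in> composable A \<rightarrow>\<^sub>E Cell C"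
      by (auto simp: lax_comp_def compose_def split: prod.split)
  next
    fix a b assume "(a, b) \<in> hcomposable A"
    then have ab: "a \<in> Cell A" "b \<in> Cell A" "tgt1 A (src2 A a) = src1 A (src2 A b)"
      by auto
    let ?a = "on2 F a" and ?b = "on2 F b"
    let ?s = "sigma F (src2 A a, src2 A b)" and ?t = "sigma F (tgt2 A a, tgt2 A b)"
    have "(sigma G (tgt2 B ?a, tgt2 B ?b) \<bullet>\<^bsub>C\<^esub> on2 G ?t) \<bullet>\<^bsub>C\<^esub> on2 G (on2 F (b \<star>\<^bsub>A\<^esub> a))
        = sigma G (tgt2 B ?a, tgt2 B ?b) \<bullet>\<^bsub>C\<^esub> on2 G (?t \<bullet>\<^bsub>B\<^esub> on2 F (b \<star>\<^bsub>A\<^esub> a))"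
      using ab by (simp add: G.B.vcomp_assoc)
    also have "\<dots> = sigma G (tgt2 B ?a, tgt2 B ?b) \<bullet>\<^bsub>C\<^esub> on2 G (?b \<star>\<^bsub>B\<^esub> ?a) \<bullet>\<^bsub>C\<^esub> on2 G ?s"
      using ab by (simp add: F.sigma_natural G.B.vcomp_assoc)
    also have "\<dots> = (on2 G ?b \<star>\<^bsub>C\<^esub> on2 G ?a) \<bullet>\<^bsub>C\<^esub> (sigma G (src2 B ?a, src2 B ?b) \<bullet>\<^bsub>C\<^esub> on2 G ?s)"
      using ab G.sigma_natural[of ?a ?b] by (simp add: G.B.vcomp_assoc)
    finally show "sigma (lax_comp A C G F) (tgt2 A a, tgt2 A b) \<bullet>\<^bsub>C\<^esub> on2 (lax_comp A C G F) (b \<star>\<^bsub>A\<^esub> a)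
        = (on2 (lax_comp A C G F) b \<star>\<^bsub>C\<^esub> on2 (lax_comp A C G F) a)
          \<bullet>\<^bsub>C\<^esub> sigma (lax_comp A C G F) (src2 A a, src2 A b)"
      using ab by simp
  next
    fix f g k assume "(f, g) \<in> composable A" "(g, k) \<in> composable A"
    then have fgk: "f \<in> Arr A" "g \<in> Arr A" "k \<in> Arr A" "tgt1 A f = src1 A g" "tgt1 A g = src1 A k"
      by auto
    let ?f = "on1 F f" and ?g = "on1 F g" and ?k = "on1 F k"
    let ?p = "sigma F (f, g)" and ?q = "sigma F (g, k)"
    let ?r = "sigma F (f, k \<cdot>\<^bsub>A\<^esub> g)" and ?s = "sigma F (g \<cdot>\<^bsub>A\<^esub> f, k)"
    let ?i = "\<lambda>u. id2 C (on1 G u)"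
    have eq: "on2 G (?q \<star>\<^bsub>B\<^esub> id2 B ?f) \<bullet>\<^bsub>C\<^esub> on2 G ?r = on2 G (id2 B ?k \<star>\<^bsub>B\<^esub> ?p) \<bullet>\<^bsub>C\<^esub> on2 G ?s"
    proof -
      have "on2 G ((?q \<star>\<^bsub>B\<^esub> id2 B ?f) \<bullet>\<^bsub>B\<^esub> ?r) = on2 G ((id2 B ?k \<star>\<^bsub>B\<^esub> ?p) \<bullet>\<^bsub>B\<^esub> ?s)"
        using F.sigma_assoc[of f g k] fgk by simp
      then show ?thesis
        using fgk by (simp add: F.A.comp1_assoc)
    qed
    \<comment> \<open>Naturality of \<open>sigma G\<close> in its second argument, at the cell
      \<open>?q\<close>, brings the two cells of \<open>sigma G\<close> together and leaves the two
      cells under \<open>on2 G\<close> adjacent. Then the coherence of \<open>G\<close> and the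
      equation \<open>eq\<close> apply, and naturality in the first argument, at the cell
      \<open>?p\<close>, undoes the rearrangement on the other side.\<close>
    have "((sigma G (?g, ?k) \<bullet>\<^bsub>C\<^esub> on2 G ?q) \<star>\<^bsub>C\<^esub> ?i ?f) \<bullet>\<^bsub>C\<^esub> (sigma G (?f, on1 F (k \<cdot>\<^bsub>A\<^esub> g)) \<bullet>\<^bsub>C\<^esub> on2 G ?r)
      = (sigma G (?g, ?k) \<star>\<^bsub>C\<^esub> ?i ?f) \<bullet>\<^bsub>C\<^esub>
          ((on2 G ?q \<star>\<^bsub>C\<^esub> ?i ?f) \<bullet>\<^bsub>C\<^esub> sigma G (?f, src2 B ?q)) \<bullet>\<^bsub>C\<^esub> on2 G ?r"
      using fgk by (simp add: G.B.whisker_vcomp G.B.vcomp_assoc)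
    also have "\<dots> = (sigma G (?g, ?k) \<star>\<^bsub>C\<^esub> ?i ?f) \<bullet>\<^bsub>C\<^esub>
          (sigma G (?f, ?k \<cdot>\<^bsub>B\<^esub> ?g) \<bullet>\<^bsub>C\<^esub> on2 G (?q \<star>\<^bsub>B\<^esub> id2 B ?f)) \<bullet>\<^bsub>C\<^esub> on2 G ?r"
      using G.sigma_natural_second[of ?q ?f] fgk by simp
    also have "\<dots> = (sigma G (?g, ?k) \<star>\<^bsub>C\<^esub> ?i ?f) \<bullet>\<^bsub>C\<^esub> sigma G (?f, ?k \<cdot>\<^bsub>B\<^esub> ?g) \<bullet>\<^bsub>C\<^esub>
          (on2 G (?q \<star>\<^bsub>B\<^esub> id2 B ?f) \<bullet>\<^bsub>C\<^esub> on2 G ?r)"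
      using fgk by (simp add: G.B.vcomp_assoc G.B.comp1_assoc F.B.comp1_assoc)
    also have "\<dots> = (?i ?k \<star>\<^bsub>C\<^esub> sigma G (?f, ?g)) \<bullet>\<^bsub>C\<^esub> sigma G (?g \<cdot>\<^bsub>B\<^esub> ?f, ?k) \<bullet>\<^bsub>C\<^esub>
          (on2 G (id2 B ?k \<star>\<^bsub>B\<^esub> ?p) \<bullet>\<^bsub>C\<^esub> on2 G ?s)"
      using fgk by (simp add: G.sigma_assoc eq)
    also have "\<dots> = (?i ?k \<star>\<^bsub>C\<^esub> sigma G (?f, ?g)) \<bullet>\<^bsub>C\<^esub>
          (sigma G (?g \<cdot>\<^bsub>B\<^esub> ?f, ?k) \<bullet>\<^bsub>C\<^esub> on2 G (id2 B ?k \<star>\<^bsub>B\<^esub> ?p)) \<bullet>\<^bsub>C\<^esub> on2 G ?s"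
      using fgk by (simp add: G.B.vcomp_assoc G.B.comp1_assoc F.B.comp1_assoc)
    also have "\<dots> = (?i ?k \<star>\<^bsub>C\<^esub> sigma G (?f, ?g)) \<bullet>\<^bsub>C\<^esub>
          ((?i ?k \<star>\<^bsub>C\<^esub> on2 G ?p) \<bullet>\<^bsub>C\<^esub> sigma G (src2 B ?p, ?k)) \<bullet>\<^bsub>C\<^esub> on2 G ?s"
      using G.sigma_natural_first[of ?p ?k] fgk by simp
    also have "\<dots> = (?i ?k \<star>\<^bsub>C\<^esub> (sigma G (?f, ?g) \<bullet>\<^bsub>C\<^esub> on2 G ?p)) \<bullet>\<^bsub>C\<^esub>
          (sigma G (on1 F (g \<cdot>\<^bsub>A\<^esub> f), ?k) \<bullet>\<^bsub>C\<^esub> on2 G ?s)"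
      using fgk by (simp add: G.B.whisker_vcomp G.B.vcomp_assoc)
    finally show "(sigma (lax_comp A C G F) (g, k) \<star>\<^bsub>C\<^esub> id2 C (on1 (lax_comp A C G F) f))
          \<bullet>\<^bsub>C\<^esub> sigma (lax_comp A C G F) (f, k \<cdot>\<^bsub>A\<^esub> g)
        = (id2 C (on1 (lax_comp A C G F) k) \<star>\<^bsub>C\<^esub> sigma (lax_comp A C G F) (f, g))
          \<bullet>\<^bsub>C\<^esub> sigma (lax_comp A C G F) (g \<cdot>\<^bsub>A\<^esub> f, k)"
      using fgk by simp
  qed auto
qed

text \<open>As \<open>on2 H\<close> preserves vertical composites, the two structure cells differ
  only by the bracketing of three factors. The composition law of the simplicial operators, the
  functoriality of the nerve and the simpliciality of \<open>Ner_map\<close> all reduce to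
  this.\<close>

lemma lax_comp_assoc:
  assumes "lax_functor A B F" and "lax_functor B C G" and "lax_functor C D H"
  shows "lax_comp A D H (lax_comp A C G F) = lax_comp A D (lax_comp B D H G) F"
proof -
  interpret F: lax_functor A B F by fact
  interpret G: lax_functor B C G by fact
  interpret H: lax_functor C D H by fact
  show ?thesis
    by (auto simp: lax_comp_def compose_def fun_eq_iff restrict_def H.B.vcomp_assoc)
qed

lemma lax_comp_lax_id:
  assumes "lax_functor A B F"
  shows "lax_comp A B (lax_id B) F = F"
proof -
  interpret F: lax_functor A B F by fact
  show ?thesis
    using F.on0 F.on1 F.on2 F.sigma
    by (auto simp: lax_comp_def lax_id_def compose_def fun_eq_iff restrict_def PiE_def extensional_def
      intro!: lax.equality)
qed

section \<open>Simplices of the nerve\<close>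

lemma two_category_ordinal: "two_category (ordinal n)"
  by unfold_locales
    (auto simp: ordinal_def composable_def vcomposable_def hcomposable_def)

lemma ordinal_sel [simp]:
  "Obj (ordinal n) = {0..n}"
  "src1 (ordinal n) = fst" "tgt1 (ordinal n) = snd"
  "src2 (ordinal n) = (\<lambda>a. a)" "tgt2 (ordinal n) = (\<lambda>a. a)"
  "id1 (ordinal n) = (\<lambda>i. (i, i))" "id2 (ordinal n) = (\<lambda>f. f)"
  "comp1 (ordinal n) g f = (fst f, snd g)" "vcomp (ordinal n) b a = a"
  "hcomp (ordinal n) b a = (fst a, snd b)"
  by (simp_all add: ordinal_def)

lemma ordinal_Arr [simp]: "(i, j) \<in> Arr (ordinal n) \<longleftrightarrow> i \<le> j \<and> j \<le> n"
  and ordinal_Cell [simp]: "(i, j) \<in> Cell (ordinal n) \<longleftrightarrow> i \<le> j \<and> j \<le> n"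
  by (simp_all add: ordinal_def)

lemma ordinal_composable [simp]:
  "((i, j), (j', k)) \<in> composable (ordinal n) \<longleftrightarrow> i \<le> j \<and> j \<le> k \<and> k \<le> n \<and> j' = j"
  by (auto simp: composable_def)

lemma simplices_Ner [simp]: "x \<in> simplices (Ner A) n \<longleftrightarrow> lax_functor (ordinal n) A x"
  by (simp add: Ner_def lax_functors_def)

lemma mono_mapsD:
  assumes "\<alpha> \<in> mono_maps m n"
  shows "i \<le> m \<Longrightarrow> \<alpha> i \<le> n" and "i \<le> j \<Longrightarrow> j \<le> m \<Longrightarrow> \<alpha> i \<le> \<alpha> j"
  using assms by (auto simp: mono_maps_def mono_on_def)

lemma ordinal_map_sel [simp]:
  "i \<le> m \<Longrightarrow> on0 (ordinal_map m \<alpha>) i = \<alpha> i"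
  "i \<le> j \<Longrightarrow> j \<le> m \<Longrightarrow> on1 (ordinal_map m \<alpha>) (i, j) = (\<alpha> i, \<alpha> j)"
  "i \<le> j \<Longrightarrow> j \<le> m \<Longrightarrow> on2 (ordinal_map m \<alpha>) (i, j) = (\<alpha> i, \<alpha> j)"
  "i \<le> j \<Longrightarrow> j \<le> k \<Longrightarrow> k \<le> m \<Longrightarrow> sigma (ordinal_map m \<alpha>) ((i, j), (j, k)) = (\<alpha> i, \<alpha> k)"
  by (simp_all add: ordinal_map_def)

lemma lax_functor_ordinal_map:
  assumes "\<alpha> \<in> mono_maps m n"
  shows "lax_functor (ordinal m) (ordinal n) (ordinal_map m \<alpha>)"
proof -
  interpret M: two_category "ordinal m" by (rule two_category_ordinal)
  interpret N: two_category "ordinal n" by (rule two_category_ordinal)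
  note mono_mapsD[OF assms, simp]
  have [simp]: "i \<le> j \<Longrightarrow> j \<le> m \<Longrightarrow> \<alpha> j \<le> n" "i \<le> j \<Longrightarrow> j \<le> k \<Longrightarrow> k \<le> m \<Longrightarrow> \<alpha> i \<le> \<alpha> k" for i j k
    by auto
  show ?thesis
  proof
    show "on0 (ordinal_map m \<alpha>) \<in> Obj (ordinal m) \<rightarrow>\<^sub>E Obj (ordinal n)"
      "on1 (ordinal_map m \<alpha>) \<in> Arr (ordinal m) \<rightarrow>\<^sub>E Arr (ordinal n)"
      "on2 (ordinal_map m \<alpha>) \<in> Cell (ordinal m) \<rightarrow>\<^sub>E Cell (ordinal n)"
      "sigma (ordinal_map m \<alpha>) \<in> composable (ordinal m) \<rightarrow>\<^sub>E Cell (ordinal n)"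
      by (auto simp: ordinal_map_def restrict_def split: prod.splits)
  qed (auto simp: vcomposable_def)
qed

lemma ordinal_map_compose:
  assumes "\<alpha> \<in> mono_maps l m" "\<beta> \<in> mono_maps m n"
  shows "ordinal_map l (compose {0..l} \<beta> \<alpha>)
    = lax_comp (ordinal l) (ordinal n) (ordinal_map m \<beta>) (ordinal_map l \<alpha>)"
proof -
  have [simp]: "i \<le> l \<Longrightarrow> \<alpha> i \<le> m" "i \<le> j \<Longrightarrow> j \<le> l \<Longrightarrow> \<alpha> i \<le> \<alpha> j" for i j
    using mono_mapsD[OF assms(1)] by auto
  show ?thesis
    by (auto simp: ordinal_map_def lax_comp_def compose_def restrict_def fun_eq_iff split: prod.splits)
qed

text \<open>The working interface to simplices: the axioms of a lax 2-functor rewritten in terms of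
  vertices, edges and chains of vertices. The last clause is the coherence equation of the
  tetrahedron on \<open>i, j, k, l\<close>.\<close>

lemma Ner_simplexD:
  assumes "lax_functor (ordinal n) A x"
  shows "i \<le> n \<Longrightarrow> on0 x i \<in> Obj A"
    and "i \<le> j \<Longrightarrow> j \<le> n \<Longrightarrow> on1 x (i, j) \<in> Arr A"
    and "i \<le> j \<Longrightarrow> j \<le> n \<Longrightarrow> src1 A (on1 x (i, j)) = on0 x i"
    and "i \<le> j \<Longrightarrow> j \<le> n \<Longrightarrow> tgt1 A (on1 x (i, j)) = on0 x j"
    and "i \<le> n \<Longrightarrow> on1 x (i, i) = id1 A (on0 x i)"
    and "i \<le> j \<Longrightarrow> j \<le> n \<Longrightarrow> on2 x (i, j) = id2 A (on1 x (i, j))"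
    and "i \<le> j \<Longrightarrow> j \<le> k \<Longrightarrow> k \<le> n \<Longrightarrow> sigma x ((i, j), (j, k)) \<in> Cell A"
    and "i \<le> j \<Longrightarrow> j \<le> k \<Longrightarrow> k \<le> n \<Longrightarrow> src2 A (sigma x ((i, j), (j, k))) = on1 x (i, k)"
    and "i \<le> j \<Longrightarrow> j \<le> k \<Longrightarrow> k \<le> n \<Longrightarrow>
      tgt2 A (sigma x ((i, j), (j, k))) = on1 x (j, k) \<cdot>\<^bsub>A\<^esub> on1 x (i, j)"
    and "i \<le> j \<Longrightarrow> j \<le> n \<Longrightarrow> sigma x ((i, i), (i, j)) = id2 A (on1 x (i, j))"
    and "i \<le> j \<Longrightarrow> j \<le> n \<Longrightarrow> sigma x ((i, j), (j, j)) = id2 A (on1 x (i, j))"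
    and "i \<le> j \<Longrightarrow> j \<le> k \<Longrightarrow> k \<le> l \<Longrightarrow> l \<le> n \<Longrightarrow>
      (sigma x ((j, k), (k, l)) \<star>\<^bsub>A\<^esub> id2 A (on1 x (i, j))) \<bullet>\<^bsub>A\<^esub> sigma x ((i, j), (j, l))
        = (id2 A (on1 x (k, l)) \<star>\<^bsub>A\<^esub> sigma x ((i, j), (j, k))) \<bullet>\<^bsub>A\<^esub> sigma x ((i, k), (k, l))"
proof -
  interpret x: lax_functor "ordinal n" A x by fact
  show "i \<le> n \<Longrightarrow> on0 x i \<in> Obj A"
    "i \<le> j \<Longrightarrow> j \<le> n \<Longrightarrow> on1 x (i, j) \<in> Arr A"
    "i \<le> j \<Longrightarrow> j \<le> n \<Longrightarrow> src1 A (on1 x (i, j)) = on0 x i"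
    "i \<le> j \<Longrightarrow> j \<le> n \<Longrightarrow> tgt1 A (on1 x (i, j)) = on0 x j"
    "i \<le> j \<Longrightarrow> j \<le> k \<Longrightarrow> k \<le> n \<Longrightarrow> sigma x ((i, j), (j, k)) \<in> Cell A"
    "i \<le> j \<Longrightarrow> j \<le> k \<Longrightarrow> k \<le> n \<Longrightarrow> src2 A (sigma x ((i, j), (j, k))) = on1 x (i, k)"
    "i \<le> j \<Longrightarrow> j \<le> k \<Longrightarrow> k \<le> n \<Longrightarrow>
      tgt2 A (sigma x ((i, j), (j, k))) = on1 x (j, k) \<cdot>\<^bsub>A\<^esub> on1 x (i, j)"
    by simp_all
  show "i \<le> n \<Longrightarrow> on1 x (i, i) = id1 A (on0 x i)" using x.on1_id1[of i] by simp
  show "i \<le> j \<Longrightarrow> j \<le> n \<Longrightarrow> on2 x (i, j) = id2 A (on1 x (i, j))" using x.on2_id2[of "(i, j)"] by simp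
  show "i \<le> j \<Longrightarrow> j \<le> n \<Longrightarrow> sigma x ((i, i), (i, j)) = id2 A (on1 x (i, j))"
    using x.sigma_id_first[of "(i, j)"] by simp
  show "i \<le> j \<Longrightarrow> j \<le> n \<Longrightarrow> sigma x ((i, j), (j, j)) = id2 A (on1 x (i, j))"
    using x.sigma_id_second[of "(i, j)"] by simp
  show "i \<le> j \<Longrightarrow> j \<le> k \<Longrightarrow> k \<le> l \<Longrightarrow> l \<le> n \<Longrightarrow>
      (sigma x ((j, k), (k, l)) \<star>\<^bsub>A\<^esub> id2 A (on1 x (i, j))) \<bullet>\<^bsub>A\<^esub> sigma x ((i, j), (j, l))
        = (id2 A (on1 x (k, l)) \<star>\<^bsub>A\<^esub> sigma x ((i, j), (j, k))) \<bullet>\<^bsub>A\<^esub> sigma x ((i, k), (k, l))"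
    using x.sigma_assoc[of "(i, j)" "(j, k)" "(k, l)"] by simp
qed

text \<open>Normality fixes the values on chains with a repeated vertex, every cell of an ordinal is
  an identity, so that \<open>on1\<close> determines \<open>on2\<close>, and extensionality fixes
  the values off the carriers.\<close>

lemma Ner_simplex_eqI:
  assumes x: "lax_functor (ordinal n) A x" and y: "lax_functor (ordinal n) A y"
    and 0: "\<And>i. i \<le> n \<Longrightarrow> on0 x i = on0 y i"
    and 1: "\<And>i j. i < j \<Longrightarrow> j \<le> n \<Longrightarrow> on1 x (i, j) = on1 y (i, j)"
    and 2: "\<And>i j k. i < j \<Longrightarrow> j < k \<Longrightarrow> k \<le> n \<Longrightarrow>
      sigma x ((i, j), (j, k)) = sigma y ((i, j), (j, k))"
  shows "x = y"
proof -
  interpret x: lax_functor "ordinal n" A x by fact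
  interpret y: lax_functor "ordinal n" A y by fact
  note X = Ner_simplexD[OF x] and Y = Ner_simplexD[OF y]
  have 1: "on1 x (i, j) = on1 y (i, j)" if "i \<le> j" "j \<le> n" for i j
    using 0 1 that X(5) Y(5) by (cases "i = j") auto
  have "on0 x = on0 y"
    by (rule PiE_ext[OF x.on0 y.on0]) (use 0 in auto)
  moreover have "on1 x = on1 y"
    by (rule PiE_ext[OF x.on1 y.on1]) (use 1 in auto)
  moreover have "on2 x = on2 y"
    by (rule PiE_ext[OF x.on2 y.on2]) (use 1 X(6) Y(6) in auto)
  moreover have "sigma x = sigma y"
  proof (rule PiE_ext[OF x.sigma y.sigma])
    fix p assume "p \<in> composable (ordinal n)"
    then obtain i j k where p: "p = ((i, j), (j, k))" "i \<le> j" "j \<le> k" "k \<le> n"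
      by (cases p) auto
    then show "sigma x p = sigma y p"
      using 1 2 X(10,11) Y(10,11) by (cases "i = j"; cases "j = k") auto
  qed
  ultimately show ?thesis by simp
qed

text \<open>The structure cells of \<open>ordinal_map m \<alpha>\<close> are identities, and so are
  their images under \<open>x\<close>; what remains of the composite structure cell is a reindexed
  cell of \<open>x\<close>.\<close>

lemma action_Ner_sel [simp]:
  assumes "lax_functor (ordinal n) A x" "\<alpha> \<in> mono_maps m n"
  shows "i \<le> m \<Longrightarrow> on0 (action (Ner A) m n \<alpha> x) i = on0 x (\<alpha> i)"
    and "i \<le> j \<Longrightarrow> j \<le> m \<Longrightarrow> on1 (action (Ner A) m n \<alpha> x) (i, j) = on1 x (\<alpha> i, \<alpha> j)"
    and "i \<le> j \<Longrightarrow> j \<le> k \<Longrightarrow> k \<le> m \<Longrightarrow>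
      sigma (action (Ner A) m n \<alpha> x) ((i, j), (j, k)) = sigma x ((\<alpha> i, \<alpha> j), (\<alpha> j, \<alpha> k))"
proof -
  interpret x: lax_functor "ordinal n" A x by fact
  note mono_mapsD[OF assms(2), simp] Ner_simplexD[OF assms(1), simp]
  show "i \<le> m \<Longrightarrow> on0 (action (Ner A) m n \<alpha> x) i = on0 x (\<alpha> i)"
    "i \<le> j \<Longrightarrow> j \<le> m \<Longrightarrow> on1 (action (Ner A) m n \<alpha> x) (i, j) = on1 x (\<alpha> i, \<alpha> j)"
    by (simp_all add: Ner_def)
  assume ijk: "i \<le> j" "j \<le> k" "k \<le> m"
  then have "\<alpha> i \<le> \<alpha> j" "\<alpha> j \<le> \<alpha> k" "\<alpha> i \<le> \<alpha> k" "\<alpha> k \<le> n" by (auto intro: order_trans)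
  with ijk show "sigma (action (Ner A) m n \<alpha> x) ((i, j), (j, k)) = sigma x ((\<alpha> i, \<alpha> j), (\<alpha> j, \<alpha> k))"
    by (simp add: Ner_def del: x.sigma_ids)
qed

lemma action_Ner_closed:
  "\<lbrakk>lax_functor (ordinal n) A x; \<alpha> \<in> mono_maps m n\<rbrakk> \<Longrightarrow>
    lax_functor (ordinal m) A (action (Ner A) m n \<alpha> x)"
  by (simp add: Ner_def lax_functor_comp[OF lax_functor_ordinal_map])

lemma id_mono_maps: "(\<lambda>i\<in>{0..n}. i) \<in> mono_maps n n"
  by (auto simp: mono_maps_def mono_on_def)

section \<open>The nerve as a functor to simplicial sets\<close>

lemma simplicial_set_Ner: "simplicial_set (Ner A)"
proof
  fix m n \<alpha> x assume "\<alpha> \<in> mono_maps m n" "x \<in> simplices (Ner A) n"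
  then show "action (Ner A) m n \<alpha> x \<in> simplices (Ner A) m" by (simp add: action_Ner_closed)
next
  fix n x assume x: "x \<in> simplices (Ner A) n"
  show "action (Ner A) n n (\<lambda>i\<in>{0..n}. i) x = x"
    by (rule Ner_simplex_eqI[of n A]) (use x in \<open>simp_all add: action_Ner_closed id_mono_maps\<close>)
next
  fix l m n \<alpha> \<beta> x
  assume "\<alpha> \<in> mono_maps l m" "\<beta> \<in> mono_maps m n" "x \<in> simplices (Ner A) n"
  then show "action (Ner A) l n (compose {0..l} \<beta> \<alpha>) x
      = action (Ner A) l m \<alpha> (action (Ner A) m n \<beta> x)"
    by (simp add: Ner_def lax_functors_def ordinal_map_compose
        lax_comp_assoc[OF lax_functor_ordinal_map lax_functor_ordinal_map])
qed

lemma Ner_map_apply [simp]: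
  "lax_functor (ordinal n) A x \<Longrightarrow> Ner_map A B F n x = lax_comp (ordinal n) B F x"
  by (simp add: Ner_map_def)

lemma Ner_map_lax_id: "Ner_map A A (lax_id A) = sset_id (Ner A)"
  by (auto simp: Ner_map_def sset_id_def fun_eq_iff restrict_def lax_comp_lax_id)

lemma Ner_map_lax_comp:
  assumes "lax_functor A B F" and "lax_functor B C G"
  shows "Ner_map A C (lax_comp A C G F) = sset_comp (Ner A) (Ner_map B C G) (Ner_map A B F)"
  using assms
  by (auto simp: Ner_map_def sset_comp_def fun_eq_iff restrict_def compose_def
      lax_comp_assoc lax_functor_comp)

lemma Ner_map_simplicial:
  assumes "lax_functor A B F"
  shows "Ner_map A B F \<in> simplicial_maps (Ner A) (Ner B)"
proof -
  have "Ner_map A B F m (action (Ner A) m n \<alpha> x) = action (Ner B) m n \<alpha> (Ner_map A B F n x)"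
    if "\<alpha> \<in> mono_maps m n" "lax_functor (ordinal n) A x" for m n \<alpha> x
    using that assms action_Ner_closed[OF that(2,1)]
    by (simp add: Ner_def lax_comp_assoc[OF lax_functor_ordinal_map])
  then show ?thesis
    using assms by (auto simp: simplicial_maps_def Ner_map_def lax_functor_comp)
qed

text \<open>Only the nondegenerate data (\<open>X1 i j\<close> for \<open>i < j\<close>, \<open>X2 i j k\<close> for \<open>i < j < k\<close>) are read off;
  normality dictates the others.\<close>

definition simplex :: "('o, 'm, 'c) twocat \<Rightarrow> nat \<Rightarrow> (nat \<Rightarrow> 'o) \<Rightarrow> (nat \<Rightarrow> nat \<Rightarrow> 'm)
    \<Rightarrow> (nat \<Rightarrow> nat \<Rightarrow> nat \<Rightarrow> 'c) \<Rightarrow> (nat, nat \<times> nat, nat \<times> nat, 'o, 'm, 'c) lax" where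
  "simplex A n X0 X1 X2 = (let e = \<lambda>i j. if i = j then id1 A (X0 i) else X1 i j in
    \<lparr>on0 = restrict X0 {0..n},
     on1 = \<lambda>(i, j)\<in>Arr (ordinal n). e i j,
     on2 = \<lambda>(i, j)\<in>Cell (ordinal n). id2 A (e i j),
     sigma = \<lambda>((i, j), (_, k))\<in>composable (ordinal n).
       if i = j then id2 A (e j k) else if j = k then id2 A (e i j) else X2 i j k\<rparr>)"

lemma simplex_sel [simp]:
  "i \<le> n \<Longrightarrow> on0 (simplex A n X0 X1 X2) i = X0 i"
  "i < j \<Longrightarrow> j \<le> n \<Longrightarrow> on1 (simplex A n X0 X1 X2) (i, j) = X1 i j"
  "i < j \<Longrightarrow> j < k \<Longrightarrow> k \<le> n \<Longrightarrow> sigma (simplex A n X0 X1 X2) ((i, j), (j, k)) = X2 i j k"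
  by (auto simp: simplex_def)

text \<open>The hypotheses speak of strict chains only: on a chain with a repeated vertex, typing
  and coherence follow from the unit laws.\<close>

lemma lax_functor_simplex:
  assumes "two_category A"
    and "\<And>i. i \<le> n \<Longrightarrow> X0 i \<in> Obj A"
    and "\<And>i j. i < j \<Longrightarrow> j \<le> n \<Longrightarrow> X1 i j \<in> Arr A \<and> src1 A (X1 i j) = X0 i \<and> tgt1 A (X1 i j) = X0 j"
    and "\<And>i j k. i < j \<Longrightarrow> j < k \<Longrightarrow> k \<le> n \<Longrightarrow> X2 i j k \<in> Cell A
      \<and> src2 A (X2 i j k) = X1 i k \<and> tgt2 A (X2 i j k) = X1 j k \<cdot>\<^bsub>A\<^esub> X1 i j"
    and assoc: "\<And>i j k l. i < j \<Longrightarrow> j < k \<Longrightarrow> k < l \<Longrightarrow> l \<le> n \<Longrightarrow>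
      (X2 j k l \<star>\<^bsub>A\<^esub> id2 A (X1 i j)) \<bullet>\<^bsub>A\<^esub> X2 i j l = (id2 A (X1 k l) \<star>\<^bsub>A\<^esub> X2 i j k) \<bullet>\<^bsub>A\<^esub> X2 i k l"
  shows "lax_functor (ordinal n) A (simplex A n X0 X1 X2)"
proof -
  interpret two_category A by fact
  interpret N: two_category "ordinal n" by (rule two_category_ordinal)
  \<comment> \<open>\<open>e\<close> and \<open>s\<close> extend the data to weakly increasing
    chains by identities. They are the edges and structure cells of \<open>?X\<close>, so the axioms
    can be checked on them without going back to the case distinctions in
    \<open>simplex\<close>.\<close>
  define e where "e i j = (if i = j then id1 A (X0 i) else X1 i j)" for i j
  define s where "s i j k = (if i = j then id2 A (e j k) else if j = k then id2 A (e i j) else X2 i j k)"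
    for i j k
  let ?X = "simplex A n X0 X1 X2"
  have e [simp]: "e i j \<in> Arr A" "src1 A (e i j) = X0 i" "tgt1 A (e i j) = X0 j"
    if "i \<le> j" "j \<le> n" for i j
    using that assms(2,3) by (auto simp: e_def)
  have ee [simp]: "e i i = id1 A (X0 i)" for i by (simp add: e_def)
  have s [simp]: "s i j k \<in> Cell A" "src2 A (s i j k) = e i k" "tgt2 A (s i j k) = e j k \<cdot>\<^bsub>A\<^esub> e i j"
    if le: "i \<le> j" "j \<le> k" "k \<le> n" for i j k
  proof -
    consider "i = j" | "j = k" | "i < j" "j < k" using le by linarith
    then have "s i j k \<in> Cell A \<and> src2 A (s i j k) = e i k \<and> tgt2 A (s i j k) = e j k \<cdot>\<^bsub>A\<^esub> e i j"
    proof cases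
      case 3
      then show ?thesis using that assms(4)[of i j k] by (simp add: s_def e_def)
    qed (use le assms(2) in \<open>auto simp: s_def\<close>)
    then show "s i j k \<in> Cell A" "src2 A (s i j k) = e i k" "tgt2 A (s i j k) = e j k \<cdot>\<^bsub>A\<^esub> e i j"
      by auto
  qed
  have se [simp]: "s i i j = id2 A (e i j)" "s i j j = id2 A (e i j)" for i j
    by (simp_all add: s_def)
  have X [simp]:
    "i \<le> j \<Longrightarrow> j \<le> n \<Longrightarrow> on1 ?X (i, j) = e i j"
    "i \<le> j \<Longrightarrow> j \<le> n \<Longrightarrow> on2 ?X (i, j) = id2 A (e i j)"
    "i \<le> j \<Longrightarrow> j \<le> k \<Longrightarrow> k \<le> n \<Longrightarrow> sigma ?X ((i, j), (j, k)) = s i j k" for i j k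
    by (simp_all add: simplex_def e_def s_def Let_def)
  have sassoc: "(s j k l \<star>\<^bsub>A\<^esub> id2 A (e i j)) \<bullet>\<^bsub>A\<^esub> s i j l = (id2 A (e k l) \<star>\<^bsub>A\<^esub> s i j k) \<bullet>\<^bsub>A\<^esub> s i k l"
    if le: "i \<le> j" "j \<le> k" "k \<le> l" "l \<le> n" for i j k l
  proof -
    consider "i = j" | "j = k" | "k = l" | "i < j" "j < k" "k < l" using le by linarith
    then show ?thesis
    proof cases
      case 4
      then show ?thesis using assoc[of i j k l] that by (simp add: s_def e_def)
    qed (use le assms(2) in auto)
  qed
  show ?thesis
  proof
    show "on0 ?X \<in> Obj (ordinal n) \<rightarrow>\<^sub>E Obj A"
      using assms(2) by (auto simp: simplex_def)
    have "on1 ?X \<in> extensional (Arr (ordinal n))" "on2 ?X \<in> extensional (Cell (ordinal n))"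
      "sigma ?X \<in> extensional (composable (ordinal n))"
      by (simp_all add: simplex_def Let_def)
    then show "on1 ?X \<in> Arr (ordinal n) \<rightarrow>\<^sub>E Arr A" "on2 ?X \<in> Cell (ordinal n) \<rightarrow>\<^sub>E Cell A"
      "sigma ?X \<in> composable (ordinal n) \<rightarrow>\<^sub>E Cell A"
      by (auto simp: PiE_iff)
  next
    fix f g k assume "(f, g) \<in> composable (ordinal n)" "(g, k) \<in> composable (ordinal n)"
    then show "(sigma ?X (g, k) \<star>\<^bsub>A\<^esub> id2 A (on1 ?X f)) \<bullet>\<^bsub>A\<^esub> sigma ?X (f, k \<cdot>\<^bsub>ordinal n\<^esub> g)
        = (id2 A (on1 ?X k) \<star>\<^bsub>A\<^esub> sigma ?X (f, g)) \<bullet>\<^bsub>A\<^esub> sigma ?X (g \<cdot>\<^bsub>ordinal n\<^esub> f, k)"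
      by (cases f; cases g; cases k) (auto simp: sassoc)
  qed (auto simp: vcomposable_def hcomposable_def)
qed

section \<open>Simplices of dimension at most three\<close>

definition vertex where "vertex A x = simplex A 0 (\<lambda>_. x) undefined undefined"

definition edge where
  "edge A f = simplex A 1 (\<lambda>i. if i = 0 then src1 A f else tgt1 A f) (\<lambda>_ _. f) undefined"

text \<open>The long edge is not a parameter: it is the source of the filler \<open>a\<close>, whose
  target is meant to be the composite of the sides \<open>f\<close> and \<open>g\<close>.\<close>

definition triangle where
  "triangle A f g a = simplex A 2
    (\<lambda>i. if i = 0 then src1 A f else if i = 1 then tgt1 A f else tgt1 A g)
    (\<lambda>i j. if i = 0 then (if j = 1 then f else src2 A a) else g) (\<lambda>_ _ _. a)"

text \<open>The sides \<open>f, g, k\<close> are the edges 01, 12, 23; the other edges are sources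
  of fillers. Edge 03 is read off \<open>c013\<close>, so a well-formed tetrahedron needs
  \<open>c023\<close> to have the same source. The nested conditionals tell apart the four strict
  triples 012, 013, 023, 123.\<close>

definition tetrahedron where
  "tetrahedron A f g k c012 c013 c023 c123 = simplex A 3
    (\<lambda>i. if i = 0 then src1 A f else if i = 1 then tgt1 A f else if i = 2 then tgt1 A g else tgt1 A k)
    (\<lambda>i j. if i = 0 then (if j = 1 then f else if j = 2 then src2 A c012 else src2 A c013)
      else if i = 1 then (if j = 2 then g else src2 A c123) else k)
    (\<lambda>i j k. if i = 1 then c123 else if j = 2 then c023 else if k = 2 then c012 else c013)"

lemma vertex_sel [simp]: "on0 (vertex A x) 0 = x"
  by (simp add: vertex_def)

lemma edge_sel [simp]:
  "on0 (edge A f) 0 = src1 A f" "on0 (edge A f) (Suc 0) = tgt1 A f" "on1 (edge A f) (0, Suc 0) = f"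
  by (simp_all add: edge_def)

lemma triangle_sel [simp]:
  "on0 (triangle A f g a) 0 = src1 A f" "on0 (triangle A f g a) (Suc 0) = tgt1 A f"
  "on0 (triangle A f g a) 2 = tgt1 A g"
  "on1 (triangle A f g a) (0, Suc 0) = f" "on1 (triangle A f g a) (0, 2) = src2 A a"
  "on1 (triangle A f g a) (Suc 0, 2) = g" "sigma (triangle A f g a) ((0, Suc 0), (Suc 0, 2)) = a"
  by (simp_all add: triangle_def)

lemma tetrahedron_sel [simp]:
  "on1 (tetrahedron A f g k c012 c013 c023 c123) (0, Suc 0) = f"
  "on1 (tetrahedron A f g k c012 c013 c023 c123) (0, 2) = src2 A c012"
  "on1 (tetrahedron A f g k c012 c013 c023 c123) (0, 3) = src2 A c013"
  "on1 (tetrahedron A f g k c012 c013 c023 c123) (Suc 0, 2) = g"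
  "on1 (tetrahedron A f g k c012 c013 c023 c123) (Suc 0, 3) = src2 A c123"
  "on1 (tetrahedron A f g k c012 c013 c023 c123) (2, 3) = k"
  "sigma (tetrahedron A f g k c012 c013 c023 c123) ((0, Suc 0), (Suc 0, 2)) = c012"
  "sigma (tetrahedron A f g k c012 c013 c023 c123) ((0, Suc 0), (Suc 0, 3)) = c013"
  "sigma (tetrahedron A f g k c012 c013 c023 c123) ((0, 2), (2, 3)) = c023"
  "sigma (tetrahedron A f g k c012 c013 c023 c123) ((Suc 0, 2), (2, 3)) = c123"
  by (simp_all add: tetrahedron_def)

context two_category
begin

lemma lax_functor_vertex: "x \<in> Obj A \<Longrightarrow> lax_functor (ordinal 0) A (vertex A x)"
  unfolding vertex_def by (rule lax_functor_simplex) (simp_all add: two_category_axioms)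

lemma lax_functor_edge: "f \<in> Arr A \<Longrightarrow> lax_functor (ordinal 1) A (edge A f)"
  unfolding edge_def by (rule lax_functor_simplex) (simp_all add: two_category_axioms)

text \<open>There is no coherence condition to check, since \<open>[2]\<close> has no strict chain
  of four vertices.\<close>

lemma lax_functor_triangle:
  assumes "f \<in> Arr A" "g \<in> Arr A" "tgt1 A f = src1 A g" "a \<in> Cell A" "tgt2 A a = g \<cdot> f"
  shows "lax_functor (ordinal 2) A (triangle A f g a)"
proof -
  \<comment> \<open>The long edge has the right ends because source and target of the 2-cell
    \<open>a\<close> are parallel.\<close>
  have [simp]: "src1 A (src2 A a) = src1 A f" "tgt1 A (src2 A a) = tgt1 A g"
    using assms src1_tgt2[of a] tgt1_tgt2[of a] by auto
  have *: "i = 0 \<and> j = 1 \<or> i = 0 \<and> j = 2 \<or> i = 1 \<and> j = 2" if "i < j" "j \<le> 2" for i j :: nat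
    using that by linarith
  have **: "i = 0 \<and> j = 1 \<and> k = 2" if "i < j" "j < k" "k \<le> 2" for i j k :: nat
    using that by linarith
  show ?thesis
    unfolding triangle_def
    by (rule lax_functor_simplex) (use assms in \<open>auto simp: two_category_axioms dest!: * **\<close>)
qed

lemma lax_functor_tetrahedron:
  assumes "f \<in> Arr A" "g \<in> Arr A" "k \<in> Arr A" "tgt1 A f = src1 A g" "tgt1 A g = src1 A k"
    and "c012 \<in> Cell A" "tgt2 A c012 = g \<cdot> f"
    and "c123 \<in> Cell A" "tgt2 A c123 = k \<cdot> g"
    and "c013 \<in> Cell A" "tgt2 A c013 = src2 A c123 \<cdot> f"
    and "c023 \<in> Cell A" "tgt2 A c023 = k \<cdot> src2 A c012" "src2 A c023 = src2 A c013"
    and coherence: "(c123 \<star> id2 A f) \<bullet> c013 = (id2 A k \<star> c012) \<bullet> c023"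
  shows "lax_functor (ordinal 3) A (tetrahedron A f g k c012 c013 c023 c123)"
proof -
  have [simp]: "src1 A (src2 A c012) = src1 A f" "tgt1 A (src2 A c012) = tgt1 A g"
    "src1 A (src2 A c123) = src1 A g" "tgt1 A (src2 A c123) = tgt1 A k"
    using assms src1_tgt2[of c012] tgt1_tgt2[of c012] src1_tgt2[of c123] tgt1_tgt2[of c123] by auto
  have [simp]: "src1 A (src2 A c013) = src1 A f" "tgt1 A (src2 A c013) = tgt1 A k"
    using assms src1_tgt2[of c013] tgt1_tgt2[of c013] by auto
  have *: "i = 0 \<and> j = 1 \<or> i = 0 \<and> j = 2 \<or> i = 1 \<and> j = 2 \<or> i = 0 \<and> j = 3 \<or> i = 1 \<and> j = 3 \<or> i = 2 \<and> j = 3"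
    if "i < j" "j \<le> 3" for i j :: nat
    using that by linarith
  have **: "i = 0 \<and> j = 1 \<and> k = 2 \<or> i = 0 \<and> j = 1 \<and> k = 3 \<or> i = 0 \<and> j = 2 \<and> k = 3 \<or> i = 1 \<and> j = 2 \<and> k = 3"
    if "i < j" "j < k" "k \<le> 3" for i j k :: nat
    using that by linarith
  have ***: "i = 0 \<and> j = 1 \<and> k = 2 \<and> l = 3" if "i < j" "j < k" "k < l" "l \<le> 3" for i j k l :: nat
    using that by linarith
  show ?thesis
    unfolding tetrahedron_def
  proof (rule lax_functor_simplex, goal_cases)
    case (4 i j k)
    from **[OF this] show ?case by (elim disjE conjE) (simp_all add: assms(1-14))
  next
    case (3 i j)
    from *[OF this] show ?case by (elim disjE conjE) (simp_all add: assms(1-14))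
  next
    case (5 i j k l)
    from ***[OF this] show ?case by (elim conjE) (simp add: coherence)
  qed (simp_all add: two_category_axioms assms(1-14))
qed

end

section \<open>The 2-functor induced by a simplicial map\<close>

text \<open>For \<open>m \<le> 2\<close> and \<open>i \<le> j \<le> k\<close>, the operator picking the vertices \<open>i, j, k\<close> (truncated to \<open>m + 1\<close>
  of them).\<close>

definition vertices_map :: "nat \<Rightarrow> nat \<Rightarrow> nat \<Rightarrow> nat \<Rightarrow> nat \<Rightarrow> nat" where
  "vertices_map m i j k = (\<lambda>l\<in>{0..m}. if l = 0 then i else if l = 1 then j else k)"

lemma vertices_map_sel [simp]:
  "vertices_map m i j k 0 = i" "m \<noteq> 0 \<Longrightarrow> vertices_map m i j k (Suc 0) = j"
  "2 \<le> m \<Longrightarrow> vertices_map m i j k 2 = k"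
  by (simp_all add: vertices_map_def)

lemma vertices_map_mono: "\<lbrakk>i \<le> j; j \<le> k; k \<le> n\<rbrakk> \<Longrightarrow> vertices_map m i j k \<in> mono_maps m n"
  by (auto simp: vertices_map_def mono_maps_def mono_on_def)

locale nerve_map = A: two_category A + B: two_category B
  for A :: "('o, 'm, 'c) twocat" and B :: "('p, 'q, 'd) twocat" +
  fixes \<phi> :: "nat \<Rightarrow> (nat, nat \<times> nat, nat \<times> nat, 'o, 'm, 'c) lax
    \<Rightarrow> (nat, nat \<times> nat, nat \<times> nat, 'p, 'q, 'd) lax"
  assumes simplicial: "\<phi> \<in> simplicial_maps (Ner A) (Ner B)"
begin

text \<open>The values of \<open>\<phi>\<close> on generic simplices of dimension 0, 1 and 2. Each
  simplex of the nerve maps to one whose data are these values at the data of the original.\<close>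

definition "obj_im x = on0 (\<phi> 0 (vertex A x)) 0"
definition "arr_im f = on1 (\<phi> 1 (edge A f)) (0, 1)"
definition "cell_im f g a = sigma (\<phi> 2 (triangle A f g a)) ((0, 1), (1, 2))"

lemma phi_simplex: "lax_functor (ordinal n) A x \<Longrightarrow> lax_functor (ordinal n) B (\<phi> n x)"
  using simplicial by (auto simp: simplicial_maps_def PiE_iff)

lemma phi_action:
  "lax_functor (ordinal n) A x \<Longrightarrow> \<alpha> \<in> mono_maps m n \<Longrightarrow>
    \<phi> m (action (Ner A) m n \<alpha> x) = action (Ner B) m n \<alpha> (\<phi> n x)"
  using simplicial by (auto simp: simplicial_maps_def)

context
  fixes n x assumes x: "lax_functor (ordinal n) A x"
begin

text \<open>The operator from \<open>[0]\<close> picking the vertex \<open>i\<close> carries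
  \<open>x\<close> to a generic vertex, and \<open>\<phi>\<close> commutes with operators. The same
  argument with \<open>[1]\<close> and \<open>[2]\<close> handles edges and structure cells.\<close>

lemma on0_phi: assumes "i \<le> n" shows "on0 (\<phi> n x) i = obj_im (on0 x i)"
proof -
  note X = Ner_simplexD[OF x]
  have m: "vertices_map 0 i i i \<in> mono_maps 0 n" using assms by (simp add: vertices_map_mono)
  have "action (Ner A) 0 n (vertices_map 0 i i i) x = vertex A (on0 x i)"
    by (rule Ner_simplex_eqI[of 0 A])
      (use assms x m X in \<open>simp_all add: action_Ner_closed A.lax_functor_vertex\<close>)
  then have "obj_im (on0 x i) = on0 (action (Ner B) 0 n (vertices_map 0 i i i) (\<phi> n x)) 0"
    by (simp add: obj_im_def phi_action[OF x m, symmetric])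
  then show ?thesis by (simp add: phi_simplex[OF x] m)
qed

lemma on1_phi: assumes "i \<le> j" "j \<le> n" shows "on1 (\<phi> n x) (i, j) = arr_im (on1 x (i, j))"
proof -
  note X = Ner_simplexD[OF x]
  have m: "vertices_map 1 i j j \<in> mono_maps 1 n" using assms by (simp add: vertices_map_mono)
  have l: "l = 0 \<or> l = 1" if "l \<le> 1" for l :: nat using that by linarith
  have "action (Ner A) 1 n (vertices_map 1 i j j) x = edge A (on1 x (i, j))"
  proof (rule Ner_simplex_eqI[of 1 A], goal_cases)
    case (3 l) from l[OF this] show ?case using assms x m X by auto
  next
    case (4 l l') then have "l = 0" "l' = 1" by auto
    then show ?case using assms x m X by auto
  qed (use assms x m X in \<open>simp_all add: action_Ner_closed A.lax_functor_edge del: One_nat_def\<close>)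
  then have "arr_im (on1 x (i, j)) = on1 (action (Ner B) 1 n (vertices_map 1 i j j) (\<phi> n x)) (0, 1)"
    by (simp add: arr_im_def phi_action[OF x m, symmetric] del: One_nat_def)
  then show ?thesis using phi_simplex[OF x] m by simp
qed

text \<open>Repeated vertices are allowed, as an operator need only be monotonic. The degenerate
  instances later show that identities are preserved.\<close>

lemma sigma_phi:
  assumes "i \<le> j" "j \<le> k" "k \<le> n"
  shows "sigma (\<phi> n x) ((i, j), (j, k))
    = cell_im (on1 x (i, j)) (on1 x (j, k)) (sigma x ((i, j), (j, k)))"
proof -
  note X = Ner_simplexD[OF x]
  have m: "vertices_map 2 i j k \<in> mono_maps 2 n" using assms by (simp add: vertices_map_mono)
  have l: "l = 0 \<or> l = 1 \<or> l = 2" if "l \<le> 2" for l :: nat using that by linarith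
  have *: "l = 0 \<and> l' = 1 \<or> l = 0 \<and> l' = 2 \<or> l = 1 \<and> l' = 2" if "l < l'" "l' \<le> 2" for l l' :: nat
    using that by linarith
  have "action (Ner A) 2 n (vertices_map 2 i j k) x
    = triangle A (on1 x (i, j)) (on1 x (j, k)) (sigma x ((i, j), (j, k)))"
  proof (rule Ner_simplex_eqI[of 2 A], goal_cases)
    case (3 l) from l[OF this] show ?case using assms x m X by auto
  next
    case (4 l l') from *[OF this] show ?case using assms x m X by auto
  next
    case (5 l l' l'') then have "l = 0" "l' = 1" "l'' = 2" by auto
    then show ?case using assms x m X by auto
  qed (use assms x m X in \<open>simp_all add: action_Ner_closed A.lax_functor_triangle\<close>)
  then have "cell_im (on1 x (i, j)) (on1 x (j, k)) (sigma x ((i, j), (j, k)))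
    = sigma (action (Ner B) 2 n (vertices_map 2 i j k) (\<phi> n x)) ((0, 1), (1, 2))"
    by (simp add: cell_im_def phi_action[OF x m, symmetric])
  then show ?thesis using phi_simplex[OF x] m by simp
qed

end

lemma obj_im_Obj [simp]: "x \<in> Obj A \<Longrightarrow> obj_im x \<in> Obj B"
  using Ner_simplexD(1)[OF phi_simplex[OF A.lax_functor_vertex], of x 0] by (simp add: obj_im_def)

lemma arr_im_Arr [simp]:
  assumes "f \<in> Arr A"
  shows "arr_im f \<in> Arr B" "src1 B (arr_im f) = obj_im (src1 A f)" "tgt1 B (arr_im f) = obj_im (tgt1 A f)"
proof -
  note x = A.lax_functor_edge[OF assms]
  show "arr_im f \<in> Arr B" "src1 B (arr_im f) = obj_im (src1 A f)" "tgt1 B (arr_im f) = obj_im (tgt1 A f)"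
    using Ner_simplexD(2-4)[OF phi_simplex[OF x], of 0 1] on0_phi[OF x, of 0] on0_phi[OF x, of 1]
    by (simp_all add: arr_im_def)
qed

text \<open>\<open>id1 A x\<close> is the degenerate edge \<open>(0, 0)\<close> of
  \<open>vertex A x\<close>. Its image is the degenerate edge of a simplex in \<open>B\<close>,
  which is an identity by normality.\<close>

lemma arr_im_id1 [simp]: assumes "x \<in> Obj A" shows "arr_im (id1 A x) = id1 B (obj_im x)"
proof -
  note x = A.lax_functor_vertex[OF assms]
  show ?thesis
    using Ner_simplexD(5)[OF phi_simplex[OF x], of 0] Ner_simplexD(5)[OF x, of 0]
      on1_phi[OF x, of 0 0] on0_phi[OF x, of 0] by simp
qed

lemma cell_im_Cell [simp]:
  assumes "f \<in> Arr A" "g \<in> Arr A" "tgt1 A f = src1 A g" "a \<in> Cell A" "tgt2 A a = g \<cdot>\<^bsub>A\<^esub> f"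
  shows "cell_im f g a \<in> Cell B" "src2 B (cell_im f g a) = arr_im (src2 A a)"
    "tgt2 B (cell_im f g a) = arr_im g \<cdot>\<^bsub>B\<^esub> arr_im f"
proof -
  note x = A.lax_functor_triangle[OF assms]
  show "cell_im f g a \<in> Cell B" "src2 B (cell_im f g a) = arr_im (src2 A a)"
    "tgt2 B (cell_im f g a) = arr_im g \<cdot>\<^bsub>B\<^esub> arr_im f"
    using Ner_simplexD(7-9)[OF phi_simplex[OF x], of 0 1 2] on1_phi[OF x, of 0 1]
      on1_phi[OF x, of 0 2] on1_phi[OF x, of 1 2]
    by (simp_all add: cell_im_def)
qed

text \<open>The two triangles are the degenerate ones on the vertices 0, 0, 1 and 0, 1, 1 of
  \<open>edge A f\<close>, and normality of the image simplex gives their values.\<close>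

lemma cell_im_id [simp]:
  assumes "f \<in> Arr A"
  shows "src1 A f = x \<Longrightarrow> cell_im (id1 A x) f (id2 A f) = id2 B (arr_im f)"
    and "tgt1 A f = x \<Longrightarrow> cell_im f (id1 A x) (id2 A f) = id2 B (arr_im f)"
proof -
  note x = A.lax_functor_edge[OF assms]
  note X = Ner_simplexD[OF x] and Y = Ner_simplexD[OF phi_simplex[OF x]]
  show "src1 A f = x \<Longrightarrow> cell_im (id1 A x) f (id2 A f) = id2 B (arr_im f)"
    using X(5)[of 0] X(10)[of 0 1] Y(10)[of 0 1] on1_phi[OF x, of 0 1] sigma_phi[OF x, of 0 0 1] by simp
  show "tgt1 A f = x \<Longrightarrow> cell_im f (id1 A x) (id2 A f) = id2 B (arr_im f)"
    using X(5)[of 1] X(11)[of 0 1] Y(11)[of 0 1] on1_phi[OF x, of 0 1] sigma_phi[OF x, of 0 1 1] by simp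
qed

text \<open>The image of a tetrahedron of \<open>A\<close> is a 3-simplex of the nerve of
  \<open>B\<close>; this is its coherence equation. The lemmas below choose the entries so that it
  becomes the equation wanted.\<close>

lemma cell_im_tetrahedron:
  assumes "f \<in> Arr A" "g \<in> Arr A" "k \<in> Arr A" "tgt1 A f = src1 A g" "tgt1 A g = src1 A k"
    and "c012 \<in> Cell A" "tgt2 A c012 = g \<cdot>\<^bsub>A\<^esub> f"
    and "c123 \<in> Cell A" "tgt2 A c123 = k \<cdot>\<^bsub>A\<^esub> g"
    and "c013 \<in> Cell A" "tgt2 A c013 = src2 A c123 \<cdot>\<^bsub>A\<^esub> f"
    and "c023 \<in> Cell A" "tgt2 A c023 = k \<cdot>\<^bsub>A\<^esub> src2 A c012" "src2 A c023 = src2 A c013"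
    and "(c123 \<star>\<^bsub>A\<^esub> id2 A f) \<bullet>\<^bsub>A\<^esub> c013 = (id2 A k \<star>\<^bsub>A\<^esub> c012) \<bullet>\<^bsub>A\<^esub> c023"
  shows "(cell_im g k c123 \<star>\<^bsub>B\<^esub> id2 B (arr_im f)) \<bullet>\<^bsub>B\<^esub> cell_im f (src2 A c123) c013
    = (id2 B (arr_im k) \<star>\<^bsub>B\<^esub> cell_im f g c012) \<bullet>\<^bsub>B\<^esub> cell_im (src2 A c012) k c023"
proof -
  note x = A.lax_functor_tetrahedron[OF assms]
  show ?thesis
    using Ner_simplexD(12)[OF phi_simplex[OF x], of 0 1 2 3]
    by (simp add: on1_phi[OF x] sigma_phi[OF x])
qed

text \<open>A cell \<open>a\<close> fills a triangle with sides \<open>tgt2 A a\<close> and an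
  identity, because its target is the composite of these two; the source of \<open>a\<close> is then
  the long edge.\<close>

definition induced :: "('o, 'm, 'c, 'p, 'q, 'd) lax" where
  "induced = \<lparr>on0 = \<lambda>x\<in>Obj A. obj_im x, on1 = \<lambda>f\<in>Arr A. arr_im f,
     on2 = \<lambda>a\<in>Cell A. cell_im (tgt2 A a) (id1 A (tgt1 A (src2 A a))) a,
     sigma = \<lambda>(f, g)\<in>composable A. cell_im f g (id2 A (g \<cdot>\<^bsub>A\<^esub> f))\<rparr>"

lemma induced_sel [simp]:
  "x \<in> Obj A \<Longrightarrow> on0 induced x = obj_im x" "f \<in> Arr A \<Longrightarrow> on1 induced f = arr_im f"
  "a \<in> Cell A \<Longrightarrow> on2 induced a = cell_im (tgt2 A a) (id1 A (tgt1 A (src2 A a))) a"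
  "\<lbrakk>f \<in> Arr A; g \<in> Arr A; tgt1 A f = src1 A g\<rbrakk> \<Longrightarrow> sigma induced (f, g) = cell_im f g (id2 A (g \<cdot>\<^bsub>A\<^esub> f))"
  by (simp_all add: induced_def)

lemma cell_im_factor:
  assumes "f \<in> Arr A" "g \<in> Arr A" "tgt1 A f = src1 A g" "a \<in> Cell A" "tgt2 A a = g \<cdot>\<^bsub>A\<^esub> f"
  shows "cell_im f g a = sigma induced (f, g) \<bullet>\<^bsub>B\<^esub> on2 induced a"
proof -
  have [simp]: "tgt1 A (src2 A a) = tgt1 A g" "src1 A (src2 A a) = src1 A f"
    using assms A.tgt1_tgt2[of a] A.src1_tgt2[of a] by auto
  show ?thesis
    \<comment> \<open>The third side is an identity, the faces 012 and 123 are identity cells, and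
      both remaining faces are \<open>a\<close>. Face 123 maps to an identity, 012 to
      \<open>sigma induced (f, g)\<close> and 023 to \<open>on2 induced a\<close>.\<close>
    using assms cell_im_tetrahedron[of f g "id1 A (tgt1 A g)" "id2 A (g \<cdot>\<^bsub>A\<^esub> f)" "id2 A g" a a]
    by simp
qed

lemma on2_induced_vcomp:
  assumes "a \<in> Cell A" "b \<in> Cell A" "tgt2 A a = src2 A b"
  shows "on2 induced (b \<bullet>\<^bsub>A\<^esub> a) = on2 induced b \<bullet>\<^bsub>B\<^esub> on2 induced a"
proof -
  let ?i = "id1 A (tgt1 A (src2 A b))"
  have [simp]: "tgt1 A (src2 A a) = tgt1 A (src2 A b)" "src1 A (src2 A a) = src1 A (src2 A b)"
    using assms A.tgt1_tgt2[of a] A.src1_tgt2[of a] by auto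
  show ?thesis
    \<comment> \<open>The last two sides and face 123 are identities. The faces 012, 023 and 013 are
      \<open>b\<close>, \<open>a\<close> and their composite, all of the shape that defines
      \<open>on2 induced\<close>.\<close>
    using assms cell_im_tetrahedron[of "tgt2 A b" ?i ?i b "id2 A ?i" "b \<bullet>\<^bsub>A\<^esub> a" a] by simp
qed

lemma induced_natural_first:
  assumes "a \<in> Cell A" "g \<in> Arr A" "tgt1 A (src2 A a) = src1 A g"
  shows "sigma induced (tgt2 A a, g) \<bullet>\<^bsub>B\<^esub> on2 induced (id2 A g \<star>\<^bsub>A\<^esub> a)
    = (id2 B (arr_im g) \<star>\<^bsub>B\<^esub> on2 induced a) \<bullet>\<^bsub>B\<^esub> sigma induced (src2 A a, g)"
  \<comment> \<open>Here the middle side is an identity, face 012 is \<open>a\<close> and face 013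
    is \<open>a\<close> whiskered by \<open>g\<close>. Reading \<open>cell_im_factor\<close> from
    right to left turns the left side into the image of face 013; the other terms are
    unfolded.\<close>
  using assms cell_im_tetrahedron[of "tgt2 A a" "id1 A (src1 A g)" g a "id2 A g"
      "id2 A g \<star>\<^bsub>A\<^esub> a" "id2 A (g \<cdot>\<^bsub>A\<^esub> src2 A a)"]
  by (simp del: induced_sel(3,4)
      add: cell_im_factor[symmetric] induced_sel(3)[of a] induced_sel(4)[of "src2 A a" g])

lemma induced_natural_second:
  assumes "b \<in> Cell A" "f \<in> Arr A" "tgt1 A f = src1 A (src2 A b)"
  shows "sigma induced (f, tgt2 A b) \<bullet>\<^bsub>B\<^esub> on2 induced (b \<star>\<^bsub>A\<^esub> id2 A f)
    = (on2 induced b \<star>\<^bsub>B\<^esub> id2 B (arr_im f)) \<bullet>\<^bsub>B\<^esub> sigma induced (f, src2 A b)"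
  \<comment> \<open>With an identity as third side, face 123 is \<open>b\<close> and face 023 is its
    whiskering by \<open>f\<close>, so each face that is not an identity cell defines a value of
    \<open>on2 induced\<close>. The faces 012 and 013 give the two structure cells.\<close>
  using assms cell_im_tetrahedron[of f "tgt2 A b" "id1 A (tgt1 A (src2 A b))" "id2 A (tgt2 A b \<cdot>\<^bsub>A\<^esub> f)" b
      "id2 A (src2 A b \<cdot>\<^bsub>A\<^esub> f)" "b \<star>\<^bsub>A\<^esub> id2 A f"]
  by simp

lemma lax_functor_induced: "lax_functor A B induced"
proof
  show "on0 induced \<in> Obj A \<rightarrow>\<^sub>E Obj B" "on1 induced \<in> Arr A \<rightarrow>\<^sub>E Arr B" "on2 induced \<in> Cell A \<rightarrow>\<^sub>E Cell B"
    "sigma induced \<in> composable A \<rightarrow>\<^sub>E Cell B"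
    by (auto simp: induced_def)
next
  fix a b assume "(a, b) \<in> vcomposable A"
  then show "on2 induced (b \<bullet>\<^bsub>A\<^esub> a) = on2 induced b \<bullet>\<^bsub>B\<^esub> on2 induced a" using on2_induced_vcomp by simp
next
  fix a b assume "(a, b) \<in> hcomposable A"
  then have ab: "a \<in> Cell A" "b \<in> Cell A" "tgt1 A (src2 A a) = src1 A (src2 A b)" by auto
  let ?f = "src2 A a" and ?f' = "tgt2 A a" and ?g = "src2 A b" and ?g' = "tgt2 A b"
  have [simp]: "on2 induced a \<in> Cell B" "src2 B (on2 induced a) = arr_im ?f" "tgt2 B (on2 induced a) = arr_im ?f'"
    "on2 induced b \<in> Cell B" "src2 B (on2 induced b) = arr_im ?g" "tgt2 B (on2 induced b) = arr_im ?g'"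
    using ab by auto
  \<comment> \<open>A horizontal composite is a vertical composite of two whiskerings, so naturality
    in each variable separately is enough.\<close>
  have "b \<star>\<^bsub>A\<^esub> a = (id2 A ?g' \<star>\<^bsub>A\<^esub> a) \<bullet>\<^bsub>A\<^esub> (b \<star>\<^bsub>A\<^esub> id2 A ?f)"
    using ab A.interchange[of "id2 A ?f" a b "id2 A ?g'"] by simp
  then have "sigma induced (?f', ?g') \<bullet>\<^bsub>B\<^esub> on2 induced (b \<star>\<^bsub>A\<^esub> a)
    = (sigma induced (?f', ?g') \<bullet>\<^bsub>B\<^esub> on2 induced (id2 A ?g' \<star>\<^bsub>A\<^esub> a))
      \<bullet>\<^bsub>B\<^esub> on2 induced (b \<star>\<^bsub>A\<^esub> id2 A ?f)"
    using ab on2_induced_vcomp[of "b \<star>\<^bsub>A\<^esub> id2 A ?f" "id2 A ?g' \<star>\<^bsub>A\<^esub> a"] by (simp add: B.vcomp_assoc)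
  also have "\<dots> = (id2 B (arr_im ?g') \<star>\<^bsub>B\<^esub> on2 induced a)
      \<bullet>\<^bsub>B\<^esub> (sigma induced (?f, ?g') \<bullet>\<^bsub>B\<^esub> on2 induced (b \<star>\<^bsub>A\<^esub> id2 A ?f))"
    using ab induced_natural_first[of a ?g']
    by (simp add: B.vcomp_assoc del: induced_sel(3)) (simp add: B.vcomp_assoc)
  also have "\<dots> = (id2 B (arr_im ?g') \<star>\<^bsub>B\<^esub> on2 induced a)
      \<bullet>\<^bsub>B\<^esub> ((on2 induced b \<star>\<^bsub>B\<^esub> id2 B (arr_im ?f)) \<bullet>\<^bsub>B\<^esub> sigma induced (?f, ?g))"
    using ab induced_natural_second[of b ?f] by simp
  also have "\<dots> = (on2 induced b \<star>\<^bsub>B\<^esub> on2 induced a) \<bullet>\<^bsub>B\<^esub> sigma induced (?f, ?g)"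
    using ab B.interchange[of "id2 B (arr_im ?f)" "on2 induced a" "on2 induced b" "id2 B (arr_im ?g')"]
    by (simp add: B.vcomp_assoc del: induced_sel(3))
  finally show "sigma induced (?f', ?g') \<bullet>\<^bsub>B\<^esub> on2 induced (b \<star>\<^bsub>A\<^esub> a)
      = (on2 induced b \<star>\<^bsub>B\<^esub> on2 induced a) \<bullet>\<^bsub>B\<^esub> sigma induced (?f, ?g)" .
next
  fix f g k assume "(f, g) \<in> composable A" "(g, k) \<in> composable A"
  then show "(sigma induced (g, k) \<star>\<^bsub>B\<^esub> id2 B (on1 induced f)) \<bullet>\<^bsub>B\<^esub> sigma induced (f, k \<cdot>\<^bsub>A\<^esub> g)
      = (id2 B (on1 induced k) \<star>\<^bsub>B\<^esub> sigma induced (f, g)) \<bullet>\<^bsub>B\<^esub> sigma induced (g \<cdot>\<^bsub>A\<^esub> f, k)"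
    \<comment> \<open>The associativity axiom comes from the tetrahedron on \<open>f, g, k\<close>
      whose four faces are identity cells.\<close>
    using cell_im_tetrahedron[of f g k "id2 A (g \<cdot>\<^bsub>A\<^esub> f)" "id2 A (k \<cdot>\<^bsub>A\<^esub> g)"
        "id2 A (k \<cdot>\<^bsub>A\<^esub> (g \<cdot>\<^bsub>A\<^esub> f))" "id2 A (k \<cdot>\<^bsub>A\<^esub> (g \<cdot>\<^bsub>A\<^esub> f))"]
    by (simp add: A.comp1_assoc)
qed auto

text \<open>Vertices and edges agree by construction. For a structure cell with sides
  \<open>f, g\<close> and filler \<open>a\<close>, \<open>cell_im_factor\<close> says that
  \<open>cell_im f g a\<close> is the structure cell of the composite with
  \<open>induced\<close>.\<close>

lemma Ner_map_induced: "Ner_map A B induced = \<phi>"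
proof (intro ext)
  fix n x
  show "Ner_map A B induced n x = \<phi> n x"
  proof (cases "lax_functor (ordinal n) A x")
    case True
    note X = Ner_simplexD[OF True]
    show ?thesis
    proof (rule Ner_simplex_eqI[of n B])
      show "lax_functor (ordinal n) B (Ner_map A B induced n x)"
        using True by (simp add: lax_functor_comp[OF _ lax_functor_induced])
      show "lax_functor (ordinal n) B (\<phi> n x)" using True by (rule phi_simplex)
    qed (use True X in \<open>simp_all add: on0_phi on1_phi sigma_phi cell_im_factor del: induced_sel(3,4)\<close>)
  next
    case False
    \<comment> \<open>Off the simplices of the nerve both sides are \<open>undefined\<close>, by
      extensionality.\<close>
    then have "x \<notin> simplices (Ner A) n" by simp
    then show ?thesis
      using simplicial by (auto simp: Ner_map_def simplicial_maps_def PiE_iff extensional_def)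
  qed
qed

end

section \<open>Faithfulness and the bijection\<close>

lemma Ner_map_faithful:
  assumes "lax_functor A B F" and "lax_functor A B G" and eq: "Ner_map A B F = Ner_map A B G"
  shows "F = G"
proof -
  interpret F: lax_functor A B F by fact
  interpret G: lax_functor A B G by fact
  have comp: "lax_comp (ordinal n) B F x = lax_comp (ordinal n) B G x"
    if "lax_functor (ordinal n) A x" for n x
    using that fun_cong[OF fun_cong[OF eq], of n x] by simp
  have "on0 F x = on0 G x" if "x \<in> Obj A" for x
    using arg_cong[OF comp[OF F.A.lax_functor_vertex[OF that]], of "\<lambda>y. on0 y 0"] by simp
  then have 0: "on0 F = on0 G" by (intro PiE_ext[OF F.on0 G.on0]) auto
  have "on1 F f = on1 G f" if "f \<in> Arr A" for f
    using arg_cong[OF comp[OF F.A.lax_functor_edge[OF that]], of "\<lambda>y. on1 y (0, 1)"] by simp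
  then have 1: "on1 F = on1 G" by (intro PiE_ext[OF F.on1 G.on1]) auto
  \<comment> \<open>The two images of the generic triangle \<open>(f, g; a)\<close> have equal
    structure cells.\<close>
  have tri: "sigma F (f, g) \<bullet>\<^bsub>B\<^esub> on2 F a = sigma G (f, g) \<bullet>\<^bsub>B\<^esub> on2 G a"
    if "f \<in> Arr A" "g \<in> Arr A" "tgt1 A f = src1 A g" "a \<in> Cell A" "tgt2 A a = g \<cdot>\<^bsub>A\<^esub> f" for f g a
    using arg_cong[OF comp[OF F.A.lax_functor_triangle[OF that]], of "\<lambda>y. sigma y ((0, 1), (1, 2))"]
    by simp
  have "sigma F p = sigma G p" if "p \<in> composable A" for p
    \<comment> \<open>With an identity filler, the factor coming from \<open>on2\<close> is an
      identity and drops out.\<close>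
    using that tri[of "fst p" "snd p" "id2 A (snd p \<cdot>\<^bsub>A\<^esub> fst p)"] 1 by (cases p) simp
  then have 2: "sigma F = sigma G" by (intro PiE_ext[OF F.sigma G.sigma]) auto
  have "on2 F a = on2 G a" if "a \<in> Cell A" for a
    \<comment> \<open>With an identity as second side, \<open>sigma\<close> is an identity by
      normality, and the factor from \<open>on2\<close> remains.\<close>
    using that tri[of "tgt2 A a" "id1 A (tgt1 A (src2 A a))" a] 1 by simp
  then have "on2 F = on2 G" by (intro PiE_ext[OF F.on2 G.on2]) auto
  with 0 1 2 show ?thesis by simp
qed

theorem proposition4p3:
  fixes A :: "('o, 'm, 'c) twocat" and B :: "('p, 'q, 'd) twocat"
  assumes "two_category A" and "two_category B"
  shows "simplicial_set (Ner A)
    \<and> Ner_map A A (lax_id A) = sset_id (Ner A)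
    \<and> (\<forall>(C :: ('u, 'v, 'w) twocat) F G.
         two_category C \<longrightarrow> F \<in> lax_functors A B \<longrightarrow> G \<in> lax_functors B C \<longrightarrow>
         Ner_map A C (lax_comp A C G F) = sset_comp (Ner A) (Ner_map B C G) (Ner_map A B F))
    \<and> bij_betw (Ner_map A B) (lax_functors A B) (simplicial_maps (Ner A) (Ner B))"
proof (intro conjI allI impI)
  show "bij_betw (Ner_map A B) (lax_functors A B) (simplicial_maps (Ner A) (Ner B))"
  proof (rule bij_betw_imageI)
    show "inj_on (Ner_map A B) (lax_functors A B)"
      by (rule inj_onI) (auto simp: lax_functors_def intro: Ner_map_faithful)
    show "Ner_map A B ` lax_functors A B = simplicial_maps (Ner A) (Ner B)"
    proof (intro equalityI subsetI)
      fix \<phi> assume "\<phi> \<in> simplicial_maps (Ner A) (Ner B)"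
      then interpret nerve_map A B \<phi>
        using assms by (simp add: nerve_map_def nerve_map_axioms_def)
      show "\<phi> \<in> Ner_map A B ` lax_functors A B"
        using imageI[of induced "lax_functors A B" "Ner_map A B"] lax_functor_induced
        by (simp add: lax_functors_def Ner_map_induced)
    qed (auto simp: lax_functors_def Ner_map_simplicial)
  qed
qed (simp_all add: lax_functors_def simplicial_set_Ner Ner_map_lax_id Ner_map_lax_comp)

end
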